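(* Let $n\ge 2$, let $X_1,\dots,X_n$ be infinite dimensional Hilbert spaces and $D_k\in\mathcal{B}(X_k)$, $1\le k\le n$. Then for every $A\in\mathcal{B}_n$, $$\bigcup_{k=1}^n\sigma_{lw}(D_k)=\sigma_{lw}(T_n^d(A))\cup\Delta_1\cup\Delta_2,$$ where $$\Delta_1=\bigcup_{k=2}^{n}\Big\{\lambda\in\mathbb{C}:\ \alpha(D_k-\lambda)=\infty,\ \alpha(D_s-\lambda)<\infty \text{ for } 2\le s\le k-1,\ \sum_{s=1}^{k-1}\beta(D_s-\lambda)=\infty\Big\}\cap\rho_{le}(D_1)\cap\Big\{\lambda\in\mathbb{C}:\ \sum_{s=1}^n\beta(D_s-\lambda)\ge\sum_{s=1}^n\alpha(D_s-\lambda)\Big\}$$ (for $k=2$ the condition on $2\le s\le k-1$ is vacuous), and $$\Delta_2=\bigcup_{k=1}^{n}\Big\{\lambda\in\mathbb{C}:\ \alpha(D_s-\lambda)<\infty \text{ for all } 1\le s\le n,\ \sum_{s=1}^n\beta(D_s-\lambda)\ge\sum_{s=1}^n\alpha(D_s-\lambda),\ \text{and } \big(\alpha(D_k-\lambda)>\beta(D_k-\lambda) \text{ or } \mathcal{R}(D_k-\lambda) \text{ is not closed}\big)\Big\}.$$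
   Context: For a bounded operator $T$ between Banach spaces, $\mathcal{N}(T)$ and $\mathcal{R}(T)$ denote its kernel and range, $\alpha(T)=\dim\mathcal{N}(T)$ and $\beta(T)=\operatorname{codim}\mathcal{R}(T)$, each taking values in $\{0,1,2,\dots\}\cup\{\infty\}$; sums and comparisons of these quantities are taken in $\{0,1,\dots\}\cup\{\infty\}$ (a sum is $\infty$ if some term is $\infty$). $\mathrm{ind}(T)=\alpha(T)-\beta(T)$ when at least one is finite. $T$ is left Fredholm if $\alpha(T)<\infty$ and $\mathcal{R}(T)$ is closed and (topologically) complemented; left Weyl if it is left Fredholm with $\mathrm{ind}(T)\le 0$. For $T\in\mathcal{B}(X)$: $\sigma_{le}(T)=\{\lambda:\lambda-T$ not left Fredholm$\}$, $\sigma_{lw}(T)=\{\lambda:\lambda-T$ not left Weyl$\}$, and $\rho_{le}(T)=\mathbb{C}\setminus\sigma_{le}(T)$. $\mathcal{B}_n$ denotes the set of all tuples $A=(A_{ij})_{1\le i<j\le n}$ with $A_{ij}\in\mathcal{B}(X_j,X_i)$, and $T_n^d(A)\in\mathcal{B}(X_1\oplus\cdots\oplus X_n)$ is the upper triangular operator matrix with diagonal entries $D_1,\dots,D_n$, entry $A_{ij}$ in position $(i,j)$ for $i<j$, and zero entries below the diagonal. *)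

theory Defs
  imports "HOL-Analysis.Analysis"
begin

text \<open>A complex Hilbert space is encoded as a real Hilbert space (type class
real_inner + complete_space, ambient type) equipped with a complex scalar
multiplication sc that extends the real one and for which multiplication by
the imaginary unit is isometric for the real inner product (so that
Re of the complex inner product is the given real inner product).
The individual spaces X_k are closed complex subspaces of such an ambient space.\<close>

definition complex_hilbert_structure ::
  "(complex \<Rightarrow> 'a::{real_inner,complete_space} \<Rightarrow> 'a) \<Rightarrow> bool" where
  "complex_hilbert_structure sc \<longleftrightarrow>
     module sc \<and>
     (\<forall>r x. sc (complex_of_real r) x = r *\<^sub>R x) \<and>
     (\<forall>x y. inner (sc \<i> x) (sc \<i> y) = inner x y)"

definition csubspace :: "(complex \<Rightarrow> 'v::real_vector \<Rightarrow> 'v) \<Rightarrow> 'v set \<Rightarrow> bool" where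
  "csubspace sc V \<longleftrightarrow> subspace V \<and> (\<forall>c. \<forall>x\<in>V. sc c x \<in> V)"

definition cdim :: "(complex \<Rightarrow> 'v::real_vector \<Rightarrow> 'v) \<Rightarrow> 'v set \<Rightarrow> enat" where
  "cdim sc S =
    (if \<exists>B. finite B \<and> B \<subseteq> S \<and> module.span sc B = S
     then enat (LEAST m. \<exists>B. finite B \<and> B \<subseteq> S \<and> card B = m \<and> module.span sc B = S)
     else \<infinity>)"

definition ccodim :: "(complex \<Rightarrow> 'v::real_vector \<Rightarrow> 'v) \<Rightarrow> 'v set \<Rightarrow> 'v set \<Rightarrow> enat" where
  "ccodim sc R V =
    (if \<exists>B. finite B \<and> B \<subseteq> V \<and> module.span sc (R \<union> B) = V
     then enat (LEAST m. \<exists>B. finite B \<and> B \<subseteq> V \<and> card B = m \<and> module.span sc (R \<union> B) = V)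
     else \<infinity>)"

definition bop :: "(complex \<Rightarrow> 'v::real_normed_vector \<Rightarrow> 'v) \<Rightarrow> 'v set \<Rightarrow>
    (complex \<Rightarrow> 'w::real_normed_vector \<Rightarrow> 'w) \<Rightarrow> 'w set \<Rightarrow> ('v \<Rightarrow> 'w) \<Rightarrow> bool" where
  "bop sc1 V sc2 W T \<longleftrightarrow>
     T ` V \<subseteq> W \<and>
     (\<forall>x\<in>V. \<forall>y\<in>V. T (x + y) = T x + T y) \<and>
     (\<forall>c. \<forall>x\<in>V. T (sc1 c x) = sc2 c (T x)) \<and>
     (\<exists>K. \<forall>x\<in>V. norm (T x) \<le> K * norm x)"

definition ker_on :: "'v set \<Rightarrow> ('v \<Rightarrow> 'v::zero) \<Rightarrow> 'v set" where
  "ker_on V T = {x \<in> V. T x = 0}"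

definition ran_on :: "'v set \<Rightarrow> ('v \<Rightarrow> 'v) \<Rightarrow> 'v set" where
  "ran_on V T = T ` V"

definition alpha_op :: "(complex \<Rightarrow> 'v::real_vector \<Rightarrow> 'v) \<Rightarrow> 'v set \<Rightarrow> ('v \<Rightarrow> 'v) \<Rightarrow> enat" where
  "alpha_op sc V T = cdim sc (ker_on V T)"

definition beta_op :: "(complex \<Rightarrow> 'v::real_vector \<Rightarrow> 'v) \<Rightarrow> 'v set \<Rightarrow> ('v \<Rightarrow> 'v) \<Rightarrow> enat" where
  "beta_op sc V T = ccodim sc (ran_on V T) V"

definition complemented_in :: "(complex \<Rightarrow> 'v::real_normed_vector \<Rightarrow> 'v) \<Rightarrow> 'v set \<Rightarrow> 'v set \<Rightarrow> bool" where
  "complemented_in sc V R \<longleftrightarrow>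
     (\<exists>P. bop sc V sc V P \<and> (\<forall>x\<in>V. P (P x) = P x) \<and> P ` V = R)"

definition left_fredholm :: "(complex \<Rightarrow> 'v::real_normed_vector \<Rightarrow> 'v) \<Rightarrow> 'v set \<Rightarrow> ('v \<Rightarrow> 'v) \<Rightarrow> bool" where
  "left_fredholm sc V T \<longleftrightarrow>
     alpha_op sc V T < \<infinity> \<and> closed (ran_on V T) \<and> complemented_in sc V (ran_on V T)"

text \<open>ind T = alpha - beta <= 0; since alpha is finite for a left Fredholm
operator, this is alpha <= beta in enat (with beta possibly infinite).\<close>
definition left_weyl :: "(complex \<Rightarrow> 'v::real_normed_vector \<Rightarrow> 'v) \<Rightarrow> 'v set \<Rightarrow> ('v \<Rightarrow> 'v) \<Rightarrow> bool" where
  "left_weyl sc V T \<longleftrightarrow> left_fredholm sc V T \<and> alpha_op sc V T \<le> beta_op sc V T"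

definition lam_minus :: "(complex \<Rightarrow> 'v \<Rightarrow> 'v) \<Rightarrow> complex \<Rightarrow> ('v \<Rightarrow> 'v) \<Rightarrow> 'v \<Rightarrow> 'v::minus" where
  "lam_minus sc z T = (\<lambda>x. sc z x - T x)"

definition minus_lam :: "(complex \<Rightarrow> 'v \<Rightarrow> 'v) \<Rightarrow> ('v \<Rightarrow> 'v) \<Rightarrow> complex \<Rightarrow> 'v \<Rightarrow> 'v::minus" where
  "minus_lam sc T z = (\<lambda>x. T x - sc z x)"

definition sigma_le :: "(complex \<Rightarrow> 'v::real_normed_vector \<Rightarrow> 'v) \<Rightarrow> 'v set \<Rightarrow> ('v \<Rightarrow> 'v) \<Rightarrow> complex set" where
  "sigma_le sc V T = {z. \<not> left_fredholm sc V (lam_minus sc z T)}"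

definition rho_le :: "(complex \<Rightarrow> 'v::real_normed_vector \<Rightarrow> 'v) \<Rightarrow> 'v set \<Rightarrow> ('v \<Rightarrow> 'v) \<Rightarrow> complex set" where
  "rho_le sc V T = - sigma_le sc V T"

definition sigma_lw :: "(complex \<Rightarrow> 'v::real_normed_vector \<Rightarrow> 'v) \<Rightarrow> 'v set \<Rightarrow> ('v \<Rightarrow> 'v) \<Rightarrow> complex set" where
  "sigma_lw sc V T = {z. \<not> left_weyl sc V (lam_minus sc z T)}"

text \<open>The direct sum X_1 + ... + X_n is realised inside 'a^'n (Hilbert norm:
the L2 norm of the component norms), the index type 'n being a finite
linear order with n = CARD('n) elements; k = 1 corresponds to the least index.\<close>

definition dsum :: "('n::finite \<Rightarrow> 'a set) \<Rightarrow> ('a ^ 'n) set" where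
  "dsum X = {x. \<forall>k. x $ k \<in> X k}"

definition dsc :: "(complex \<Rightarrow> 'a \<Rightarrow> 'a) \<Rightarrow> complex \<Rightarrow> 'a ^ 'n::finite \<Rightarrow> 'a ^ 'n" where
  "dsc sc c x = (\<chi> k. sc c (x $ k))"

definition Bn :: "(complex \<Rightarrow> 'a::real_normed_vector \<Rightarrow> 'a) \<Rightarrow> ('n::{finite,linorder} \<Rightarrow> 'a set)
    \<Rightarrow> ('n \<Rightarrow> 'n \<Rightarrow> 'a \<Rightarrow> 'a) \<Rightarrow> bool" where
  "Bn sc X A \<longleftrightarrow> (\<forall>i j. i < j \<longrightarrow> bop sc (X j) sc (X i) (A i j))"

definition Tnd :: "('n::{finite,linorder} \<Rightarrow> 'a::comm_monoid_add \<Rightarrow> 'a) \<Rightarrow> ('n \<Rightarrow> 'n \<Rightarrow> 'a \<Rightarrow> 'a)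
    \<Rightarrow> ('a, 'n) vec \<Rightarrow> ('a, 'n) vec" where
  "Tnd D A x = (\<chi> i. D i (x $ i) + (\<Sum>j\<in>{j. i < j}. A i j (x $ j)))"

end

(* For fixed z write E_k = D_k - z and let T be the triangular operator with diagonal E_k.
   In a Hilbert space closed subspaces are complemented, so an operator is left Fredholm iff its
   kernel is finite dimensional and its range is closed; by the open mapping theorem this is the
   same as having finite dimensional kernel and being proper on bounded sequences (a bounded
   sequence with convergent images has a convergent subsequence).  Properness passes from all E_k
   to T one row at a time and from T to its restriction E_1.
   Nullities and deficiencies are compared through the exact kernel-cokernel sequence of
   T restricted to the first m summands, relative to the first m-1: for finite nullities it gives
   sum alpha(E_k) + beta(T) = alpha(T) + sum beta(E_k), and at the first k with alpha(E_k)
   infinite it forces, when alpha(T) is finite, sum_{s<k} beta(E_s) to be infinite. *)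
theory Submission
  imports Defs
begin

section \<open>Codimensions of complex subspaces\<close>

text \<open>Nullities and deficiencies take values in \<open>enat\<close>, where differences are
  meaningless at infinity. The index therefore never occurs as a number: every identity is additive,
  and a summand is cancelled only once it is known to be finite. Kernels and cokernels are both
  treated as codimensions of nested subspaces, {0} in N(T) and R(T) in V, so that one tower law
  produces all dimension counts. The shape of Delta_1 and Delta_2 reflects which information T
  loses. The first summand is invariant under T, so a left Weyl T forces E_1 to be left Fredholm;
  later entries are seen only modulo the summands before them. A later entry can have infinite
  nullity if the earlier deficiencies absorb it (Delta_1). If all nullities are finite, an entry can
  still have positive index or a range that is not closed (Delta_2). Conversely a point of Delta_1
  or Delta_2 exhibits an entry that is not left Weyl, so the reverse inclusion only has to show that
  a left Weyl diagonal makes T left Weyl.\<close>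

definition ecard :: "'b set \<Rightarrow> enat" where
  "ecard B = (if finite B then enat (card B) else \<infinity>)"

lemma ecard_Un_disjoint: "A \<inter> B = {} \<Longrightarrow> ecard (A \<union> B) = ecard A + ecard B"
  by (simp add: ecard_def card_Un_disjoint)

lemma ccodim_le_card:
  assumes "finite B" "B \<subseteq> V" "module.span sc (R \<union> B) = V"
  shows "ccodim sc R V \<le> enat (card B)"
proof -
  have "(LEAST m. \<exists>B. finite B \<and> B \<subseteq> V \<and> card B = m \<and> module.span sc (R \<union> B) = V) \<le> card B"
    by (rule Least_le) (use assms in blast)
  then show ?thesis using assms by (auto simp: ccodim_def)
qed

lemma ccodim_attained:
  assumes "ccodim sc R V \<noteq> \<infinity>"
  obtains B where "finite B" "B \<subseteq> V" "module.span sc (R \<union> B) = V" "ccodim sc R V = enat (card B)"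
proof -
  have ex: "\<exists>B. finite B \<and> B \<subseteq> V \<and> module.span sc (R \<union> B) = V"
    using assms by (auto simp: ccodim_def split: if_splits)
  then have "\<exists>m. \<exists>B. finite B \<and> B \<subseteq> V \<and> card B = m \<and> module.span sc (R \<union> B) = V" by blast
  from LeastI_ex[OF this] that ex show ?thesis by (auto simp: ccodim_def)
qed

text \<open>Moves finite generating sets of one quotient to another without enlarging them, which
  compares codimensions with the infinite case included. The two isomorphism theorems below use it
  once in each direction.\<close>

lemma ccodim_mono_transfer:
  assumes "\<And>B. finite B \<Longrightarrow> B \<subseteq> V \<Longrightarrow> module.span s1 (R \<union> B) = V \<Longrightarrow>
     \<exists>B'. finite B' \<and> B' \<subseteq> V' \<and> card B' \<le> card B \<and> module.span s2 (R' \<union> B') = V'"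
  shows "ccodim s2 R' V' \<le> ccodim s1 R V"
proof (cases "ccodim s1 R V = \<infinity>")
  case False
  then obtain B where B: "finite B" "B \<subseteq> V" "module.span s1 (R \<union> B) = V" "ccodim s1 R V = enat (card B)"
    by (rule ccodim_attained)
  obtain B' where B': "finite B'" "B' \<subseteq> V'" "card B' \<le> card B" "module.span s2 (R' \<union> B') = V'"
    using assms B by blast
  have "ccodim s2 R' V' \<le> enat (card B')" using B' by (intro ccodim_le_card)
  also have "\<dots> \<le> ccodim s1 R V" using B B' by simp
  finally show ?thesis .
qed simp

text \<open>Brings nullities into the calculus of codimensions, so that kernels and cokernels obey
  the same rules.\<close>

lemma cdim_eq_ccodim:
  assumes "vector_space sc" "module.subspace sc V"
  shows "cdim sc V = ccodim sc {0} V"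
proof -
  interpret vector_space sc by fact
  have "span ({0} \<union> B) = span B" for B by simp
  then show ?thesis unfolding cdim_def ccodim_def by (simp only:)
qed

text \<open>A linear projection that kills the basis of R reduces the relative
exchange argument to the finite one.\<close>
lemma ccodim_eq_ecard:
  assumes vs: "vector_space sc" and ind: "\<not> module.dependent sc (B \<union> E)" and disj: "B \<inter> E = {}"
    and R: "module.span sc B = R" and V: "module.span sc (B \<union> E) = V"
  shows "ccodim sc R V = ecard E"
proof -
  interpret vector_space sc by fact
  interpret vp: vector_space_pair sc sc by unfold_locales
  have span_RE: "span (R \<union> C) = span (B \<union> C)" for C
    unfolding R[symmetric] by (simp add: span_Un span_span)
  have lower: "finite E \<and> card E \<le> card C" if C: "finite C" "C \<subseteq> V" "span (R \<union> C) = V" for C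
  proof -
    obtain g where g: "Vector_Spaces.linear sc sc g" "\<forall>x\<in>B \<union> E. g x = (if x \<in> B then 0 else x)"
      using vp.linear_independent_extend[OF ind, of "\<lambda>x. if x \<in> B then 0 else x"] by auto
    interpret g: Vector_Spaces.linear sc sc g by fact
    have gE: "g ` E = E" using g(2) disj by (force simp: image_iff)
    have gB: "g ` B \<subseteq> {0}" using g(2) by auto
    have "E \<subseteq> span (B \<union> C)" using V C(3) span_RE[of C] span_superset[of "B \<union> E"] by auto
    then have "g ` E \<subseteq> g ` span (B \<union> C)" by blast
    also have "\<dots> = span (g ` B \<union> g ` C)" by (simp add: g.span_image[symmetric] image_Un)
    also have "\<dots> \<subseteq> span ({0} \<union> g ` C)" using gB by (intro span_mono) auto
    also have "\<dots> = span (g ` C)" by simp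
    finally have "E \<subseteq> span (g ` C)" using gE by simp
    moreover have "independent E" using ind by (meson independent_mono sup_ge2)
    ultimately have "finite E \<and> card E \<le> card (g ` C)"
      using independent_span_bound[of "g ` C" E] C(1) by auto
    then show ?thesis using card_image_le[OF C(1), of g] by linarith
  qed
  show ?thesis
  proof (cases "finite E")
    case True
    have sub: "E \<subseteq> V" using V span_superset by blast
    have "span (R \<union> E) = V" using span_RE V by simp
    then have le: "ccodim sc R V \<le> enat (card E)" using True sub by (intro ccodim_le_card)
    then have "ccodim sc R V \<noteq> \<infinity>" by (cases "ccodim sc R V") auto
    then obtain C where "finite C" "C \<subseteq> V" "span (R \<union> C) = V" "ccodim sc R V = enat (card C)"
      by (rule ccodim_attained)
    with lower[of C] le True show ?thesis by (simp add: ecard_def)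
  next
    case False
    then show ?thesis using lower ccodim_attained[of sc R V] by (metis ecard_def)
  qed
qed

text \<open>Bases \<open>B\<close>, \<open>C\<close>, \<open>E\<close> of the three nested spaces
  are chosen by successive extension; the codimensions then count \<open>C - B\<close>,
  \<open>E - C\<close> and \<open>E - B\<close>. No finiteness is assumed.\<close>

lemma ccodim_add:
  assumes vs: "vector_space sc" and sub: "module.subspace sc R" "module.subspace sc S" "module.subspace sc V"
    and le: "R \<subseteq> S" "S \<subseteq> V"
  shows "ccodim sc R V = ccodim sc R S + ccodim sc S V"
proof -
  interpret vector_space sc by fact
  obtain B where B: "B \<subseteq> R" "independent B" "R \<subseteq> span B"
    using maximal_independent_subset by blast
  obtain C where C: "B \<subseteq> C" "C \<subseteq> S" "independent C" "S \<subseteq> span C"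
    using maximal_independent_subset_extend[of B S] B le by blast
  obtain E where E: "C \<subseteq> E" "E \<subseteq> V" "independent E" "V \<subseteq> span E"
    using maximal_independent_subset_extend[of C V] C le by blast
  have spB: "span B = R" using B sub by (metis span_subspace)
  have spC: "span C = S" using C sub by (metis span_subspace)
  have spE: "span E = V" using E sub by (metis span_subspace)
  have 1: "ccodim sc R S = ecard (C - B)"
    by (rule ccodim_eq_ecard[OF vs, of B]) (use B C spB spC in \<open>auto simp: Un_absorb1\<close>)
  have 2: "ccodim sc S V = ecard (E - C)"
    by (rule ccodim_eq_ecard[OF vs, of C]) (use C E spE spC in \<open>auto simp: Un_absorb1\<close>)
  have 3: "ccodim sc R V = ecard (E - B)"
    by (rule ccodim_eq_ecard[OF vs, of B]) (use B C E spE spB in \<open>auto simp: Un_absorb1\<close>)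
  have "E - B = (C - B) \<union> (E - C)" using C E by auto
  then show ?thesis using 1 2 3 ecard_Un_disjoint[of "C - B" "E - C"] by auto
qed

text \<open>The map induced by \<open>f\<close> from V/R onto f(V)/f(R) is injective, because
  \<open>ker\<close> puts the kernel of \<open>f\<close> on V inside R.\<close>

lemma ccodim_image:
  assumes lin: "Vector_Spaces.linear s1 s2 f"
    and sub: "module.subspace s1 R" "module.subspace s1 V" and le: "R \<subseteq> V"
    and ker: "\<And>x. x \<in> V \<Longrightarrow> f x = 0 \<Longrightarrow> x \<in> R"
  shows "ccodim s2 (f ` R) (f ` V) = ccodim s1 R V"
proof (rule antisym)
  interpret Vector_Spaces.linear s1 s2 f by fact
  show "ccodim s2 (f ` R) (f ` V) \<le> ccodim s1 R V"
  proof (rule ccodim_mono_transfer)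
    fix B assume B: "finite B" "B \<subseteq> V" "vs1.span (R \<union> B) = V"
    have "vs2.span (f ` R \<union> f ` B) = f ` V"
      using span_image[of "R \<union> B"] B(3) by (simp add: image_Un)
    then show "\<exists>B'. finite B' \<and> B' \<subseteq> f ` V \<and> card B' \<le> card B \<and> vs2.span (f ` R \<union> B') = f ` V"
      using B by (intro exI[of _ "f ` B"]) (auto simp: card_image_le)
  qed
  show "ccodim s1 R V \<le> ccodim s2 (f ` R) (f ` V)"
  proof (rule ccodim_mono_transfer)
    fix C assume C: "finite C" "C \<subseteq> f ` V" "vs2.span (f ` R \<union> C) = f ` V"
    \<comment> \<open>A set of preimages on which \<open>f\<close> is injective, so that lifting
      generators does not increase their number.\<close>
    obtain B where B: "B \<subseteq> V" "finite B" "C = f ` B" "card B = card C"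
      using C by (metis card_image finite_image_iff subset_image_inj)
    have "vs1.span (R \<union> B) = V"
    proof (rule vs1.span_subspace)
      show "R \<union> B \<subseteq> V" using le B by auto
      show "vs1.subspace V" by fact
      show "V \<subseteq> vs1.span (R \<union> B)"
      proof
        fix x assume x: "x \<in> V"
        have "f ` V = f ` vs1.span (R \<union> B)"
          using C(3) B(3) span_image[of "R \<union> B"] by (simp add: image_Un)
        then obtain y where y: "y \<in> vs1.span (R \<union> B)" "f x = f y" using x by blast
        have yV: "y \<in> V" using y(1) vs1.span_minimal[of "R \<union> B" V] le B sub by blast
        have "x - y \<in> R" using ker[of "x - y"] x yV y(2) sub(2) vs1.subspace_diff diff by simp
        then have "x - y \<in> vs1.span (R \<union> B)" by (simp add: vs1.span_base)
        from vs1.span_add[OF this y(1)] show "x \<in> vs1.span (R \<union> B)" by simp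
      qed
    qed
    then show "\<exists>B'. finite B' \<and> B' \<subseteq> V \<and> card B' \<le> card C \<and> vs1.span (R \<union> B') = V"
      using B by auto
  qed
qed

text \<open>The second isomorphism theorem: (R + V)/R is isomorphic to V/(R \<inter> V).\<close>

lemma ccodim_sum_Int:
  assumes vs: "vector_space sc" and sub: "module.subspace sc R" "module.subspace sc V"
  shows "ccodim sc R {r + v | r v. r \<in> R \<and> v \<in> V} = ccodim sc (R \<inter> V) V" (is "ccodim sc R ?S = _")
proof (rule antisym)
  interpret vector_space sc by fact
  have RS: "R \<subseteq> ?S" using subspace_0[OF sub(2)] by force
  have VS: "V \<subseteq> ?S" using subspace_0[OF sub(1)] by force
  have S: "subspace ?S" using subspace_sums sub by blast
  have R: "span R = R" and V: "span V = V" using sub by auto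
  show "ccodim sc R ?S \<le> ccodim sc (R \<inter> V) V"
  proof (rule ccodim_mono_transfer)
    fix B assume B: "finite B" "B \<subseteq> V" "span (R \<inter> V \<union> B) = V"
    have "span (R \<union> B) = ?S"
    proof (rule span_subspace)
      show "R \<union> B \<subseteq> ?S" using RS VS B by auto
      have "R \<subseteq> span (R \<union> B)" by (auto intro: span_base)
      moreover have "V \<subseteq> span (R \<union> B)" using B(3) span_mono[of "R \<inter> V \<union> B" "R \<union> B"] by auto
      ultimately show "?S \<subseteq> span (R \<union> B)" by (auto intro!: span_add)
    qed fact
    then show "\<exists>B'. finite B' \<and> B' \<subseteq> ?S \<and> card B' \<le> card B \<and> span (R \<union> B') = ?S"
      using B VS by (intro exI[of _ B]) auto
  qed
  show "ccodim sc (R \<inter> V) V \<le> ccodim sc R ?S"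
  proof (rule ccodim_mono_transfer)
    fix B assume B: "finite B" "B \<subseteq> ?S" "span (R \<union> B) = ?S"
    \<comment> \<open>Modulo R each generator can be replaced by its component in V.\<close>
    have "\<forall>b\<in>B. \<exists>v\<in>V. b - v \<in> R"
    proof
      fix b assume "b \<in> B"
      then obtain r v where "b = r + v" "r \<in> R" "v \<in> V" using B by blast
      then show "\<exists>v\<in>V. b - v \<in> R" by (intro bexI[of _ v]) auto
    qed
    then obtain h where h: "\<And>b. b \<in> B \<Longrightarrow> h b \<in> V \<and> b - h b \<in> R" by metis
    have "span (R \<inter> V \<union> h ` B) = V"
    proof (rule span_subspace)
      show "R \<inter> V \<union> h ` B \<subseteq> V" using h by auto
      show "V \<subseteq> span (R \<inter> V \<union> h ` B)"
      proof
        fix x assume x: "x \<in> V"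
        have sh: "span (h ` B) \<subseteq> V" using h sub(2) by (intro span_minimal) auto
        have "B \<subseteq> span (R \<union> h ` B)"
        proof
          fix b assume b: "b \<in> B"
          have "b - h b \<in> span (R \<union> h ` B)" "h b \<in> span (R \<union> h ` B)" using h[OF b] b by (auto intro: span_base)
          from span_add[OF this] show "b \<in> span (R \<union> h ` B)" by simp
        qed
        then have "span (R \<union> B) \<subseteq> span (R \<union> h ` B)"
          by (intro span_minimal) (auto intro: span_base)
        then have "x \<in> span (R \<union> h ` B)" using x VS B(3) by auto
        then obtain r y where ry: "x = r + y" "r \<in> R" "y \<in> span (h ` B)"
          unfolding span_Un R by blast
        have "r = x - y" using ry by simp
        then have "r \<in> V" using x ry sh subspace_diff[OF sub(2)] by blast
        then have "r \<in> span (R \<inter> V \<union> h ` B)" using ry by (auto intro: span_base)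
        moreover have "y \<in> span (R \<inter> V \<union> h ` B)" using ry(3) span_mono[of "h ` B" "R \<inter> V \<union> h ` B"] by auto
        ultimately show "x \<in> span (R \<inter> V \<union> h ` B)" using ry(1) span_add by auto
      qed
    qed fact
    then show "\<exists>B'. finite B' \<and> B' \<subseteq> V \<and> card B' \<le> card B \<and> span (R \<inter> V \<union> B') = V"
      using B h by (intro exI[of _ "h ` B"]) (auto simp: card_image_le)
  qed
qed

section \<open>The kernel-cokernel sequence\<close>

lemma ker_on_subspace:
  assumes "Vector_Spaces.linear sc sc T" "module.subspace sc W"
  shows "module.subspace sc (ker_on W T)"
proof -
  interpret Vector_Spaces.linear sc sc T by fact
  have "ker_on W T = W \<inter> {x. T x = 0}" by (auto simp: ker_on_def)
  then show ?thesis using vs1.subspace_inter[OF assms(2) subspace_kernel] by simp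
qed

lemma alpha_op_eq_ccodim:
  assumes "Vector_Spaces.linear sc sc T" "module.subspace sc W"
  shows "alpha_op sc W T = ccodim sc {0} (ker_on W T)"
  unfolding alpha_op_def using assms(1)
  by (intro cdim_eq_ccodim ker_on_subspace[OF assms]) (simp add: Vector_Spaces.linear_def)

lemma alpha_op_mono:
  assumes T: "Vector_Spaces.linear sc sc T" and sub: "module.subspace sc V" "module.subspace sc W" "V \<subseteq> W"
  shows "alpha_op sc V T \<le> alpha_op sc W T"
proof -
  interpret Vector_Spaces.linear sc sc T by fact
  have "alpha_op sc W T = ccodim sc {0} (ker_on V T) + ccodim sc (ker_on V T) (ker_on W T)"
    unfolding alpha_op_eq_ccodim[OF T sub(2)]
    by (rule ccodim_add)
      (use sub vs1.subspace_0[OF sub(1)] in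
        \<open>auto simp: ker_on_def zero vs1.vector_space_axioms intro!: ker_on_subspace[OF T, unfolded ker_on_def]\<close>)
  then show ?thesis by (simp add: alpha_op_eq_ccodim[OF T sub(1)])
qed

text \<open>Dimension count along the exact sequence
0 -> N(T|V) -> N(T|W) -> N(B) -> V/R(T|V) -> W/R(T|W) -> Y/R(B) -> 0;
the alternating sum is split over both sides because subtraction fails at infinity.\<close>
lemma kernel_cokernel_sequence:
  fixes s1 :: "complex \<Rightarrow> 'v::real_vector \<Rightarrow> 'v" and s2 :: "complex \<Rightarrow> 'w::real_vector \<Rightarrow> 'w"
  assumes T: "Vector_Spaces.linear s1 s1 T" and B: "Vector_Spaces.linear s2 s2 B"
    and p: "Vector_Spaces.linear s1 s2 p"
    and W: "module.subspace s1 W" and TW: "T ` W \<subseteq> W"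
    and comm: "\<And>x. x \<in> W \<Longrightarrow> p (T x) = B (p x)"
    and V: "V = {x \<in> W. p x = 0}" and Y: "Y = p ` W"
  shows "alpha_op s1 V T + alpha_op s2 Y B + beta_op s1 W T = alpha_op s1 W T + beta_op s1 V T + beta_op s2 Y B"
    and "alpha_op s1 W T \<le> alpha_op s1 V T + alpha_op s2 Y B"
    and "alpha_op s2 Y B \<le> alpha_op s1 W T + beta_op s1 V T"
proof -
  interpret T: Vector_Spaces.linear s1 s1 T by fact
  interpret B: Vector_Spaces.linear s2 s2 B by fact
  interpret p: Vector_Spaces.linear s1 s2 p by fact
  note vs1 = T.vs1.vector_space_axioms and vs2 = B.vs1.vector_space_axioms
  have sV: "T.vs1.subspace V"
  proof -
    have "V = W \<inter> {x. p x = 0}" by (auto simp: V)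
    then show ?thesis using T.vs1.subspace_inter[OF W p.subspace_kernel] by simp
  qed
  have sY: "B.vs1.subspace Y" unfolding Y using W by (rule p.subspace_image)
  have VW: "V \<subseteq> W" by (auto simp: V)
  define K where "K = ker_on W T"
  have sK: "T.vs1.subspace K" unfolding K_def by (rule ker_on_subspace[OF T W])
  have KW: "K \<subseteq> W" by (auto simp: K_def ker_on_def)
  have kV: "ker_on V T = K \<inter> V" using VW by (auto simp: K_def ker_on_def)
  have sKV: "T.vs1.subspace (K \<inter> V)" using sK sV by (rule T.vs1.subspace_inter)
  have zV: "0 \<in> V" using sV T.vs1.subspace_0 by blast
  have zK: "0 \<in> K" using sK T.vs1.subspace_0 by blast
  define N where "N = ker_on Y B"
  have sN: "B.vs1.subspace N" unfolding N_def by (rule ker_on_subspace[OF B sY])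
  have pKN: "p ` K \<subseteq> N"
    using comm by (auto simp: K_def N_def ker_on_def Y B.zero p.zero) (metis p.zero)
  have spK: "B.vs1.subspace (p ` K)" using sK by (rule p.subspace_image)
  \<comment> \<open>Domain of the connecting map N(B) -> V/T(V), which sends \<open>p x\<close> to
    the class of \<open>T x\<close>. By \<open>L_iff\<close> these are exactly the vectors of W that
    T moves into V.\<close>
  define L where "L = {x \<in> W. p x \<in> N}"
  have sL: "T.vs1.subspace L"
  proof -
    have "L = W \<inter> p -` N" by (auto simp: L_def)
    then show ?thesis using T.vs1.subspace_inter[OF W p.subspace_vimage[OF sN]] by simp
  qed
  have pL: "p ` L = N" by (auto simp: L_def N_def ker_on_def Y)
  have L_iff: "x \<in> L \<longleftrightarrow> x \<in> W \<and> T x \<in> V" for x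
    using comm TW by (auto simp: L_def N_def ker_on_def Y V)
  have TL: "T ` L = T ` W \<inter> V" using L_iff by auto
  \<comment> \<open>The vectors of L on which the connecting map vanishes: changing x by V alters
    \<open>T x\<close> only within T(V), and changing it by K does not alter
    \<open>T x\<close>.\<close>
  define VK where "VK = {v + k | v k. v \<in> V \<and> k \<in> K}"
  have sVK: "T.vs1.subspace VK" unfolding VK_def by (rule T.vs1.subspace_sums[OF sV sK])
  have VVK: "V \<subseteq> VK" using zK by (force simp: VK_def)
  have KVK: "K \<subseteq> VK" using zV by (force simp: VK_def)
  have VL: "V \<subseteq> L" using sN B.vs1.subspace_0 by (auto simp: V L_def)
  have KL: "K \<subseteq> L" using pKN KW by (auto simp: L_def)
  have VKL: "VK \<subseteq> L" using VL KL T.vs1.subspace_add[OF sL] by (force simp: VK_def)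
  have pVK: "p ` VK = p ` K"
  proof
    show "p ` VK \<subseteq> p ` K" by (auto simp: VK_def p.add V)
  qed (use KVK in blast)
  have TVK: "T ` VK = T ` V"
  proof
    show "T ` VK \<subseteq> T ` V" by (auto simp: VK_def T.add K_def ker_on_def)
  qed (use VVK in blast)
  have sTV: "T.vs1.subspace (T ` V)" and sTW: "T.vs1.subspace (T ` W)"
    using sV W T.subspace_image by auto
  have TVV: "T ` V \<subseteq> T ` W \<inter> V" using TL VL by blast
  \<comment> \<open>The ranks of the successive maps of the exact sequence, with \<open>r1\<close> =
    dim N(T|V) at the left end and \<open>r5\<close> = codim R(B) at the right end. Each of the four
    inner terms is the sum of two neighbouring ranks, which makes all three claims
    immediate.\<close>
  define r1 r2 r3 r4 r5 where "r1 = ccodim s1 {0} (K \<inter> V)" and "r2 = ccodim s2 {0} (p ` K)"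
    and "r3 = ccodim s2 (p ` K) N" and "r4 = ccodim s1 (T ` W \<inter> V) V" and "r5 = beta_op s2 Y B"
  have aV: "alpha_op s1 V T = r1"
    unfolding alpha_op_eq_ccodim[OF T sV] kV r1_def ..
  have "ccodim s1 (K \<inter> V) K = ccodim s2 (p ` (K \<inter> V)) (p ` K)"
    by (rule ccodim_image[OF p sKV sK, symmetric]) (use KW in \<open>auto simp: V\<close>)
  also have "p ` (K \<inter> V) = {0}" using zK zV by (auto simp: V p.zero intro!: image_eqI[of _ _ 0])
  finally have aW: "alpha_op s1 W T = r1 + r2"
    unfolding alpha_op_eq_ccodim[OF T W] K_def[symmetric] r1_def r2_def
    using ccodim_add[OF vs1 T.vs1.subspace_single_0 sKV sK] zK zV by simp
  have aB: "alpha_op s2 Y B = r2 + r3"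
    unfolding alpha_op_eq_ccodim[OF B sY] N_def[symmetric] r2_def r3_def
    using ccodim_add[OF vs2 B.vs1.subspace_single_0 spK sN] pKN zK p.zero by force
  \<comment> \<open>L/(V + K) is computed twice, through T as T(L)/T(V) and through p as N/p(K).
    Their equality says that the connecting map has the same rank at both ends.\<close>
  have "ccodim s1 (T ` VK) (T ` L) = ccodim s1 VK L"
    by (rule ccodim_image[OF T sVK sL VKL]) (use KVK in \<open>auto simp: K_def ker_on_def L_def\<close>)
  moreover have "ccodim s2 (p ` VK) (p ` L) = ccodim s1 VK L"
    by (rule ccodim_image[OF p sVK sL VKL]) (use VVK in \<open>auto simp: V L_def\<close>)
  ultimately have "ccodim s1 (T ` V) (T ` W \<inter> V) = r3"
    by (simp add: TVK TL pVK pL r3_def)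
  then have bV: "beta_op s1 V T = r3 + r4"
    unfolding beta_op_def ran_on_def r4_def
    using ccodim_add[OF vs1 sTV T.vs1.subspace_inter[OF sTW sV] sV TVV] by simp
  \<comment> \<open>W/T(W) is split at S = T(W) + V: the part S/T(W) is the image of V/T(V), and p
    identifies W/S with Y/R(B).\<close>
  define S where "S = {r + v | r v. r \<in> T ` W \<and> v \<in> V}"
  have sS: "T.vs1.subspace S" unfolding S_def by (rule T.vs1.subspace_sums[OF sTW sV])
  have TWS: "T ` W \<subseteq> S" using zV by (force simp: S_def)
  have VS: "V \<subseteq> S" using T.vs1.subspace_0[OF sTW] by (force simp: S_def)
  have SW: "S \<subseteq> W" using TW VW T.vs1.subspace_add[OF W] by (force simp: S_def)
  have "ccodim s1 (T ` W) S = r4" unfolding S_def r4_def by (rule ccodim_sum_Int[OF vs1 sTW sV])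
  moreover have "ccodim s1 S W = r5"
  proof -
    have "ccodim s2 (p ` S) (p ` W) = ccodim s1 S W"
      by (rule ccodim_image[OF p sS W SW]) (use VS in \<open>auto simp: V\<close>)
    moreover have "p ` S = B ` Y"
    proof
      show "p ` S \<subseteq> B ` Y" using comm by (auto simp: S_def p.add V Y)
      have "p (T x) \<in> p ` S" if "x \<in> W" for x using TWS that by blast
      then show "B ` Y \<subseteq> p ` S" using comm by (auto simp: Y)
    qed
    ultimately show ?thesis by (simp add: r5_def beta_op_def ran_on_def Y)
  qed
  ultimately have bW: "beta_op s1 W T = r4 + r5"
    unfolding beta_op_def ran_on_def using ccodim_add[OF vs1 sTW sS W TWS SW] by simp
  have bB: "beta_op s2 Y B = r5" by (simp add: r5_def)
  show "alpha_op s1 V T + alpha_op s2 Y B + beta_op s1 W T = alpha_op s1 W T + beta_op s1 V T + beta_op s2 Y B"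
    unfolding aV aW aB bV bW bB by (simp add: ac_simps)
  show "alpha_op s1 W T \<le> alpha_op s1 V T + alpha_op s2 Y B"
    unfolding aV aW aB by (simp add: add.assoc[symmetric])
  show "alpha_op s2 Y B \<le> alpha_op s1 W T + beta_op s1 V T"
  proof -
    have "r2 + r3 \<le> (r1 + r2) + (r3 + r4)" 
      by (intro add_mono) (auto simp: add.commute[of r1])
    then show ?thesis unfolding aW aB bV .
  qed
qed

section \<open>Orthogonal projections and operators with closed range\<close>

text \<open>A minimizing sequence for the distance to M is Cauchy by the parallelogram law, and
  minimality of its limit along every line in M gives orthogonality.\<close>

lemma orthogonal_projection_exists:
  fixes x :: "'v::{real_inner,complete_space}"
  assumes M: "subspace M" "closed M"
  shows "\<exists>y\<in>M. \<forall>m\<in>M. inner (x - y) m = 0"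
proof -
  define d where "d = infdist x M"
  have ne: "M \<noteq> {}" using subspace_0[OF M(1)] by auto
  have d0: "d \<ge> 0" by (simp add: d_def infdist_nonneg)
  have dle: "d \<le> norm (x - m)" if "m \<in> M" for m
    using infdist_le[OF that, of x] by (simp add: d_def dist_norm)
  have "\<exists>m\<in>M. norm (x - m) < d + 1 / real (Suc n)" for n
  proof (rule ccontr)
    assume "\<not> ?thesis"
    then have "\<forall>m\<in>M. d + 1 / real (Suc n) \<le> dist x m" by (auto simp: dist_norm not_less)
    then have "d + 1 / real (Suc n) \<le> infdist x M"
      unfolding infdist_def using ne by (auto intro!: cINF_greatest)
    then show False by (simp add: d_def)
  qed
  then obtain u where u: "\<And>n. u n \<in> M" "\<And>n. norm (x - u n) < d + 1 / real (Suc n)" by metis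
  \<comment> \<open>The midpoint of \<open>u m\<close> and \<open>u n\<close> lies in M, so its
    distance to x is at least \<open>d\<close>; the parallelogram law then bounds how far apart the
    two points can be.\<close>
  have key: "(norm (u m - u n))\<^sup>2 \<le> (8 * d + 4) * e"
    if e: "norm (x - u m) < d + e" "norm (x - u n) < d + e" "0 < e" "e \<le> 1" for m n e
  proof -
    define a where "a = x - u m"
    define b where "b = x - u n"
    have "(1/2) *\<^sub>R (u m + u n) \<in> M" using u M by (intro subspace_scale subspace_add) auto
    from dle[OF this] have "d \<le> norm ((1/2) *\<^sub>R (a + b))"
      by (simp add: a_def b_def algebra_simps flip: scaleR_add_left)
    then have "2 * d \<le> norm (a + b)" by simp
    then have 1: "(2 * d)\<^sup>2 \<le> (norm (a + b))\<^sup>2" using d0 by (intro power_mono) auto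
    have 2: "(norm (a - b))\<^sup>2 + (norm (a + b))\<^sup>2 = 2 * (norm a)\<^sup>2 + 2 * (norm b)\<^sup>2"
      by (simp add: power2_norm_eq_inner inner_diff inner_add inner_commute algebra_simps)
    have 3: "(norm a)\<^sup>2 \<le> (d + e)\<^sup>2" "(norm b)\<^sup>2 \<le> (d + e)\<^sup>2"
      using e by (auto intro!: power_mono simp: a_def b_def)
    have "a - b = u n - u m" by (simp add: a_def b_def)
    then have "(norm (u m - u n))\<^sup>2 = (norm (a - b))\<^sup>2" by (simp add: norm_minus_commute)
    also have "\<dots> \<le> 4 * (d + e)\<^sup>2 - (2 * d)\<^sup>2" using 1 2 3 by linarith
    also have "\<dots> = (8 * d + 4 * e) * e" by (simp add: power2_eq_square algebra_simps)
    also have "\<dots> \<le> (8 * d + 4) * e" using e by (intro mult_right_mono) auto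
    finally show ?thesis .
  qed
  have "Cauchy u"
  proof (rule metric_CauchyI)
    fix \<epsilon> :: real assume \<epsilon>: "0 < \<epsilon>"
    \<comment> \<open>The cap 1 is required by \<open>key\<close>; the 5 in place of its 4 makes the
      final inequality strict and keeps the denominator positive for \<open>d = 0\<close>.\<close>
    define e where "e = min 1 (\<epsilon>\<^sup>2 / (8 * d + 5))"
    have e: "0 < e" "e \<le> 1" using \<epsilon> d0 by (auto simp: e_def)
    have "(8 * d + 4) * e < (8 * d + 5) * e" using e by simp
    also have "\<dots> \<le> (8 * d + 5) * (\<epsilon>\<^sup>2 / (8 * d + 5))" using d0 by (intro mult_left_mono) (auto simp: e_def)
    also have "\<dots> = \<epsilon>\<^sup>2" using d0 by simp
    finally have lt: "(8 * d + 4) * e < \<epsilon>\<^sup>2" .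
    obtain N where N: "1 / real (Suc N) < e" using e nat_approx_posE by blast
    have close: "norm (x - u n) < d + e" if "n \<ge> N" for n
    proof -
      have "1 / real (Suc n) \<le> 1 / real (Suc N)" using that by (simp add: frac_le)
      then show ?thesis using u(2)[of n] N by linarith
    qed
    have "dist (u m) (u n) < \<epsilon>" if "m \<ge> N" "n \<ge> N" for m n
    proof -
      have "(norm (u m - u n))\<^sup>2 < \<epsilon>\<^sup>2" using key[OF close close e] that lt by force
      then show ?thesis using \<epsilon> by (simp add: dist_norm power2_less_imp_less)
    qed
    then show "\<exists>M. \<forall>m\<ge>M. \<forall>n\<ge>M. dist (u m) (u n) < \<epsilon>" by blast
  qed
  then obtain y where y: "u \<longlonglongrightarrow> y" using Cauchy_convergent convergent_def by blast
  have yM: "y \<in> M" using y u M(2) closed_sequentially by blast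
  have "(\<lambda>n. norm (x - u n)) \<longlonglongrightarrow> norm (x - y)" by (intro tendsto_intros y)
  moreover have "(\<lambda>n. d + 1 / real (Suc n)) \<longlonglongrightarrow> d + 0"
    using LIMSEQ_inverse_real_of_nat by (intro tendsto_intros) (simp add: inverse_eq_divide)
  ultimately have "norm (x - y) \<le> d + 0" using u(2) by (intro LIMSEQ_le) (auto intro: less_imp_le)
  then have min: "norm (x - y) \<le> norm (x - m)" if "m \<in> M" for m using dle[OF that] by simp
  have "inner (x - y) m = 0" if m: "m \<in> M" for m
  proof (cases "m = 0")
    case False
    define w where "w = x - y"
    \<comment> \<open>The \<open>t\<close> that minimizes the norm of
      \<open>w - t *\<^sub>R m\<close>; any nonzero inner product would make this norm smaller than
      that of \<open>w\<close>.\<close>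
    define t where "t = inner w m / inner m m"
    have mm: "inner m m > 0" using False by simp
    have "y + t *\<^sub>R m \<in> M" using yM m M by (intro subspace_add subspace_scale)
    from min[OF this] have "norm w \<le> norm (w - t *\<^sub>R m)" by (simp add: w_def algebra_simps)
    then have "(norm w)\<^sup>2 \<le> (norm (w - t *\<^sub>R m))\<^sup>2" by (intro power_mono) auto
    also have "\<dots> = inner w w - 2 * t * inner w m + t * t * inner m m"
      by (simp add: power2_norm_eq_inner inner_diff inner_commute algebra_simps)
    also have "\<dots> = inner w w - (inner w m)\<^sup>2 / inner m m"
      using mm by (simp add: t_def power2_eq_square field_simps)
    finally have "(inner w m)\<^sup>2 / inner m m \<le> 0" by (simp add: power2_norm_eq_inner)
    then show ?thesis using mm by (simp add: divide_le_0_iff w_def)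
  qed simp
  then show ?thesis using yM by blast
qed

definition oproj :: "'v::real_inner set \<Rightarrow> 'v \<Rightarrow> 'v" where
  "oproj M x = (SOME y. y \<in> M \<and> (\<forall>m\<in>M. inner (x - y) m = 0))"

context
  fixes M :: "'v::{real_inner,complete_space} set"
  assumes M: "subspace M" "closed M"
begin

lemma oproj_in: "oproj M x \<in> M"
  and oproj_orth: "m \<in> M \<Longrightarrow> inner (x - oproj M x) m = 0"
  using someI_ex[of "\<lambda>y. y \<in> M \<and> (\<forall>m\<in>M. inner (x - y) m = 0)"] orthogonal_projection_exists[OF M, of x]
  by (auto simp: oproj_def)

lemma oproj_unique:
  assumes "y \<in> M" "\<And>m. m \<in> M \<Longrightarrow> inner (x - y) m = 0"
  shows "oproj M x = y"
proof -
  have d: "oproj M x - y \<in> M" using oproj_in assms(1) subspace_diff[OF M(1)] by blast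
  have "inner (oproj M x - y) (oproj M x - y) = inner (x - y) (oproj M x - y) - inner (x - oproj M x) (oproj M x - y)"
    by (simp add: inner_diff)
  also have "\<dots> = 0" using assms(2)[OF d] oproj_orth[OF d] by simp
  finally show ?thesis by simp
qed

lemma oproj_id: "x \<in> M \<Longrightarrow> oproj M x = x"
  by (rule oproj_unique) auto

lemma bounded_linear_oproj: "bounded_linear (oproj M)"
proof (rule bounded_linear_intro[where K = 1])
  fix x y :: 'v
  show "oproj M (x + y) = oproj M x + oproj M y"
  proof (rule oproj_unique)
    show "oproj M x + oproj M y \<in> M" using oproj_in M by (auto intro: subspace_add)
    fix m assume "m \<in> M"
    then show "inner (x + y - (oproj M x + oproj M y)) m = 0"
      using oproj_orth[of m x] oproj_orth[of m y] by (simp add: inner_diff inner_add)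
  qed
next
  fix r and x :: 'v
  show "oproj M (r *\<^sub>R x) = r *\<^sub>R oproj M x"
  proof (rule oproj_unique)
    show "r *\<^sub>R oproj M x \<in> M" using oproj_in M by (auto intro: subspace_scale)
    fix m assume "m \<in> M"
    then have "r * inner (x - oproj M x) m = 0" using oproj_orth[of m x] by simp
    then show "inner (r *\<^sub>R x - r *\<^sub>R oproj M x) m = 0"
      by (simp add: inner_diff right_diff_distrib)
  qed
next
  fix x :: 'v
  have "(norm (oproj M x))\<^sup>2 = inner x (oproj M x)"
    using oproj_orth[OF oproj_in, of x x] by (simp add: power2_norm_eq_inner inner_diff)
  also have "\<dots> \<le> norm x * norm (oproj M x)" by (rule norm_cauchy_schwarz)
  finally have "norm (oproj M x) * norm (oproj M x) \<le> norm x * norm (oproj M x)"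
    by (simp add: power2_eq_square)
  then show "norm (oproj M x) \<le> norm x * 1"
    by (cases "oproj M x = 0") auto
qed

end

text \<open>The open mapping argument: by Baire some image of a ball is dense in a neighbourhood
of the range, and successive approximation turns density into solvability with a norm bound.\<close>
lemma bounded_below_if_closed_range:
  fixes f :: "'v::{real_normed_vector,complete_space} \<Rightarrow> 'w::{real_normed_vector,complete_space}"
  assumes f: "bounded_linear f" and M: "subspace M" "closed M"
    and inj: "\<And>x. x \<in> M \<Longrightarrow> f x = 0 \<Longrightarrow> x = 0" and cl: "closed (f ` M)"
  shows "\<exists>c>0. \<forall>x\<in>M. c * norm x \<le> norm (f x)"
proof -
  interpret f: bounded_linear f by fact
  define R where "R = f ` M"
  define X where "X = top_of_set R"
  \<comment> \<open>Closed subsets exhausting the range. The range is closed, hence completely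
    metrizable, and Baire gives one of them interior points relative to \<open>R\<close>.\<close>
  define G where "G = (\<lambda>n::nat. closure (f ` (M \<inter> cball 0 (real n))))"
  have R: "subspace R" unfolding R_def using M f.linear_axioms
    by (simp add: linear_subspace_image)
  have GR: "G n \<subseteq> R" for n unfolding G_def R_def by (rule closure_minimal[OF _ cl]) auto
  have UG: "\<Union>(range G) = R"
  proof
    show "R \<subseteq> \<Union>(range G)"
    proof
      fix y assume "y \<in> R"
      then obtain x where x: "x \<in> M" "y = f x" by (auto simp: R_def)
      obtain n where "norm x \<le> real n" using real_arch_simple by blast
      then have "y \<in> G n" using x unfolding G_def by (intro subsetD[OF closure_subset]) auto
      then show "y \<in> \<Union>(range G)" by blast
    qed
  qed (use GR in blast)
  have cm: "completely_metrizable_space X"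
    unfolding X_def using cl by (intro completely_metrizable_space_closedin[OF completely_metrizable_space_euclidean]) (simp add: R_def)
  have "\<exists>n. X interior_of (G n) \<noteq> {}"
  proof (rule ccontr)
    assume "\<not> ?thesis"
    moreover have "closedin X (G n)" for n
      using GR unfolding X_def by (intro closed_subset) (auto simp: G_def)
    ultimately have "X interior_of \<Union>(range G) = {}"
      using cm by (intro Baire_category_alt) auto
    moreover have "X interior_of R = R" using interior_of_topspace[of X] by (simp add: X_def)
    ultimately show False using UG subspace_0[OF R] by auto
  qed
  then obtain n y0 where y0: "y0 \<in> X interior_of (G n)" by blast
  have "openin X (X interior_of (G n))" by simp
  then obtain e where e: "e > 0" "\<And>y. y \<in> R \<Longrightarrow> dist y y0 < e \<Longrightarrow> y \<in> X interior_of (G n)"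
    using y0 unfolding X_def openin_euclidean_subtopology_iff by metis
  have sub: "X interior_of (G n) \<subseteq> G n" by (rule interior_of_subset)
  have y0G: "y0 \<in> G n" using y0 sub by blast
  have y0R: "y0 \<in> R" using y0G GR by blast
  \<comment> \<open>Approximating both \<open>y0 + y\<close> and \<open>y0\<close> and subtracting
    moves the ball from \<open>y0\<close> to the origin. This accounts for the radius
    \<open>2 * real n\<close> and the halves of \<delta>.\<close>
  have small: "\<exists>x\<in>M. norm x \<le> 2 * real n \<and> norm (y - f x) < \<delta>" if y: "y \<in> R" "norm y < e" "\<delta> > 0" for y \<delta>
  proof -
    have "y0 + y \<in> G n" using e(2)[of "y0 + y"] y y0R R sub by (auto simp: dist_norm subspace_add)
    then obtain x1 where x1: "x1 \<in> M" "norm x1 \<le> real n" "dist (f x1) (y0 + y) < \<delta> / 2"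
      using y(3) unfolding G_def closure_approachable by (force dest: spec[of _ "\<delta> / 2"])
    obtain x2 where x2: "x2 \<in> M" "norm x2 \<le> real n" "dist (f x2) y0 < \<delta> / 2"
      using y0G y(3) unfolding G_def closure_approachable by (force dest: spec[of _ "\<delta> / 2"])
    have "norm (x1 - x2) \<le> 2 * real n" using x1 x2 norm_triangle_ineq4[of x1 x2] by linarith
    moreover have eq: "y - f (x1 - x2) = (y0 + y - f x1) - (y0 - f x2)" by (simp add: f.diff)
    have "norm (y - f (x1 - x2)) \<le> norm (y0 + y - f x1) + norm (y0 - f x2)"
      unfolding eq by (rule norm_triangle_ineq4)
    then have "norm (y - f (x1 - x2)) < \<delta>"
      using x1(3) x2(3) by (simp only: dist_norm norm_minus_commute[of "f x1"] norm_minus_commute[of "f x2"])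
    moreover have "x1 - x2 \<in> M" using x1 x2 M by (simp add: subspace_diff)
    ultimately show ?thesis by blast
  qed
  \<comment> \<open>From \<open>small\<close> applied to \<open>y\<close> rescaled to norm e/2: a
    solution of size 2n for norm e/2 is one of relative size 4n/e.\<close>
  define K where "K = 4 * real n / e"
  have K0: "K \<ge> 0" using e by (simp add: K_def)
  have step: "\<exists>x\<in>M. norm x \<le> K * norm y \<and> norm (y - f x) \<le> norm y / 2" if y: "y \<in> R" for y
  proof (cases "y = 0")
    case True
    then show ?thesis using subspace_0[OF M(1)] by (intro bexI[of _ 0]) auto
  next
    case False
    define r where "r = e / (2 * norm y)"
    have r: "r > 0" using False e by (simp add: r_def)
    have "r *\<^sub>R y \<in> R" "norm (r *\<^sub>R y) < e"
      using y R False e by (auto simp: subspace_scale r_def)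
    then obtain x where x: "x \<in> M" "norm x \<le> 2 * real n" "norm (r *\<^sub>R y - f x) < r * norm y / 2"
      using small[of "r *\<^sub>R y" "r * norm y / 2"] r False by auto
    define x' where "x' = (1 / r) *\<^sub>R x"
    have 1: "x' \<in> M" using x M by (simp add: x'_def subspace_scale)
    have "norm x' = norm x / r" using r by (simp add: x'_def)
    also have "\<dots> \<le> 2 * real n / r" using x r by (simp add: divide_right_mono)
    also have "\<dots> = K * norm y" using False e by (simp add: r_def K_def field_simps)
    finally have 2: "norm x' \<le> K * norm y" .
    have "y - f x' = (1 / r) *\<^sub>R (r *\<^sub>R y - f x)" using r by (simp add: x'_def f.scaleR algebra_simps)
    then have "norm (y - f x') = norm (r *\<^sub>R y - f x) / r" using r by simp
    also have "\<dots> \<le> (r * norm y / 2) / r" using x r by (intro divide_right_mono) auto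
    also have "\<dots> = norm y / 2" using r by simp
    finally show ?thesis using 1 2 by blast
  qed
  then obtain g where g: "\<And>y. y \<in> R \<Longrightarrow> g y \<in> M" "\<And>y. y \<in> R \<Longrightarrow> norm (g y) \<le> K * norm y"
     "\<And>y. y \<in> R \<Longrightarrow> norm (y - f (g y)) \<le> norm y / 2" by metis
  have bound: "norm x \<le> 2 * K * norm (f x)" if x: "x \<in> M" for x
  proof -
    define y where "y = f x"
    \<comment> \<open>Residuals of the successive approximation: each one is corrected by its
      approximate solution \<open>g\<close> and is at least halved.\<close>
    define z where "z = rec_nat y (\<lambda>_ z. z - f (g z))"
    have z0: "z 0 = y" and zS: "\<And>k. z (Suc k) = z k - f (g (z k))" by (simp_all add: z_def)
    have zR: "z k \<in> R" for k
      by (induction k) (use x g(1) R in \<open>auto simp: z0 zS y_def R_def intro!: subspace_diff\<close>)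
    have zn: "norm (z k) \<le> norm y / 2 ^ k" for k
    proof (induction k)
      case (Suc k)
      have "norm (z (Suc k)) \<le> norm (z k) / 2" using g(3)[OF zR] by (simp add: zS)
      also have "\<dots> \<le> (norm y / 2 ^ k) / 2" using Suc by (intro divide_right_mono) auto
      finally show ?case by (simp add: field_simps)
    qed (simp add: z0)
    define s where "s = (\<lambda>k. \<Sum>i<k. g (z i))"
    have sM: "s k \<in> M" for k unfolding s_def using g(1) zR M by (intro subspace_sum) auto
    have fs: "f (s k) = y - z k" for k
      by (induction k) (auto simp: s_def z0 zS f.add f.zero)
    \<comment> \<open>The bracket records the exact geometric sum from \<open>k\<close> to
      \<open>k + j - 1\<close>; the weaker bound in \<open>sd'\<close> would not survive the
      induction.\<close>
    have sd: "norm (s (k + j) - s k) \<le> 2 * K * norm y * (1 / 2 ^ k - 1 / 2 ^ (k + j))" for k j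
    proof (induction j)
      case (Suc j)
      have "norm (s (k + Suc j) - s k) \<le> norm (s (k + j) - s k) + norm (g (z (k + j)))"
        using norm_triangle_ineq[of "s (k + j) - s k" "g (z (k + j))"] by (simp add: s_def algebra_simps)
      also have "norm (g (z (k + j))) \<le> K * norm (z (k + j))" using g(2) zR by blast
      also have "\<dots> \<le> K * (norm y / 2 ^ (k + j))" using zn K0 by (intro mult_left_mono) auto
      finally have "norm (s (k + Suc j) - s k)
          \<le> 2 * K * norm y * (1 / 2 ^ k - 1 / 2 ^ (k + j)) + K * (norm y / 2 ^ (k + j))"
        using Suc by linarith
      also have "\<dots> = 2 * K * norm y * (1 / 2 ^ k - 1 / 2 ^ (k + Suc j))" by (simp add: field_simps)
      finally show ?case .
    qed simp
    have sd': "norm (s (k + j) - s k) \<le> 2 * K * norm y / 2 ^ k" for k j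
      using sd[of k j] K0 by (simp add: right_diff_distrib) (smt (verit) divide_nonneg_pos mult_nonneg_nonneg norm_ge_zero zero_less_power)
    have "Cauchy s"
    proof (rule metric_CauchyI)
      fix \<epsilon> :: real assume \<epsilon>: "0 < \<epsilon>"
      have "(\<lambda>k. 2 * K * norm y * (1 / 2) ^ k) \<longlonglongrightarrow> 2 * K * norm y * 0"
        by (intro tendsto_intros LIMSEQ_power_zero) auto
      then have "(\<lambda>k. 2 * K * norm y / 2 ^ k) \<longlonglongrightarrow> 0" by (simp add: power_divide)
      then have "eventually (\<lambda>k. 2 * K * norm y / 2 ^ k < \<epsilon> / 2) sequentially"
        using \<epsilon> by (intro order_tendstoD(2)) auto
      then obtain N where N: "2 * K * norm y / 2 ^ N < \<epsilon> / 2" by (auto simp: eventually_sequentially)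
      have close: "norm (s m - s N) < \<epsilon> / 2" if "m \<ge> N" for m
        using sd'[of N "m - N"] N that by simp
      have "dist (s m) (s n) < \<epsilon>" if "m \<ge> N" "n \<ge> N" for m n
        using close[OF that(1)] close[OF that(2)] dist_triangle2[of "s m" "s n" "s N"] by (simp add: dist_norm)
      then show "\<exists>M. \<forall>m\<ge>M. \<forall>n\<ge>M. dist (s m) (s n) < \<epsilon>" by blast
    qed
    then obtain l where l: "s \<longlonglongrightarrow> l" using Cauchy_convergent convergent_def by blast
    have lM: "l \<in> M" using l sM M(2) closed_sequentially by blast
    have z_lim: "z \<longlonglongrightarrow> 0"
    proof (rule Lim_null_comparison)
      show "\<forall>\<^sub>F k in sequentially. norm (z k) \<le> norm y * (1 / 2) ^ k"
        using zn by (simp add: power_divide)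
      have "(\<lambda>k. norm y * (1 / 2) ^ k) \<longlonglongrightarrow> norm y * 0"
        by (intro tendsto_intros LIMSEQ_power_zero) auto
      then show "(\<lambda>k. norm y * (1 / 2) ^ k) \<longlonglongrightarrow> 0" by simp
    qed
    have "(\<lambda>k. f (s k)) \<longlonglongrightarrow> y - 0" unfolding fs by (intro tendsto_intros z_lim)
    moreover have "(\<lambda>k. f (s k)) \<longlonglongrightarrow> f l" by (rule f.tendsto[OF l])
    ultimately have "f l = y" using LIMSEQ_unique by fastforce
    then have "f (l - x) = 0" by (simp add: f.diff y_def)
    \<comment> \<open>Successive approximation bounds some solution of \<open>f l = f x\<close>;
      injectivity turns this into a bound for \<open>x\<close> itself.\<close>
    then have "l = x" using inj[of "l - x"] lM x M by (simp add: subspace_diff)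
    then have "(\<lambda>k. norm (s k)) \<longlonglongrightarrow> norm x" using l by (intro tendsto_norm) auto
    moreover have "norm (s k) \<le> 2 * K * norm y" for k using sd'[of 0 k] by (simp add: s_def)
    ultimately show ?thesis unfolding y_def using LIMSEQ_le_const2 by blast
  qed
  show ?thesis
  \<comment> \<open>The summand 1 keeps the constant meaningful when \<open>K = 0\<close>, which
    happens for \<open>n = 0\<close>.\<close>
  proof (intro exI[of _ "1 / (2 * K + 1)"] conjI ballI)
    show "0 < 1 / (2 * K + 1)" using K0 by simp
    fix x assume "x \<in> M"
    then have "norm x \<le> (2 * K + 1) * norm (f x)"
      using bound[of x] norm_ge_zero[of "f x"] unfolding distrib_right by linarith
    then show "1 / (2 * K + 1) * norm x \<le> norm (f x)" using K0 by (simp add: field_simps)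
  qed
qed

text \<open>Bolzano-Weierstrass for a finite dimensional subspace of a space that may be infinite
  dimensional. Orthogonality makes the coefficient of \<open>b\<close> an inner product quotient,
  bounded by Cauchy-Schwarz, so one direction at a time can be split off.\<close>

lemma bounded_seq_in_orthogonal_span:
  fixes x :: "nat \<Rightarrow> 'v::real_inner"
  assumes "finite C" "pairwise orthogonal C" "\<And>n. x n \<in> span C" "bounded (range x)"
  shows "\<exists>r l. strict_mono (r :: nat \<Rightarrow> nat) \<and> (x \<circ> r) \<longlonglongrightarrow> l"
  using assms
proof (induction C arbitrary: x rule: finite_induct)
  case empty
  then show ?case by (intro exI[of _ id] exI[of _ 0]) (auto simp: strict_mono_def o_def)
next
  case (insert b C)
  show ?case
  proof (cases "b = 0")
    case True
    then show ?thesis using insert by (auto simp: pairwise_insert)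
  next
    case False
    define c where "c = (\<lambda>n. inner (x n) b / inner b b)"
    define y where "y = (\<lambda>n. x n - c n *\<^sub>R b)"
    have orth: "inner w b = 0" if "w \<in> span C" for w
    proof -
      have "orthogonal b w"
        using insert.prems(1) insert.hyps(2) that
        by (intro orthogonal_to_span[of w C]) (auto simp: pairwise_insert)
      then show ?thesis by (simp add: orthogonal_def inner_commute)
    qed
    have yC: "y n \<in> span C" for n
    proof -
      obtain t where t: "x n - t *\<^sub>R b \<in> span C" using insert.prems(2)[of n] by (auto simp: span_insert)
      then have "inner (x n) b = t * inner b b" using orth[OF t] by (simp add: inner_diff)
      then have "c n = t" using False by (simp add: c_def)
      then show ?thesis using t by (simp add: y_def)
    qed
    obtain K where K: "\<And>n. norm (x n) \<le> K" using insert.prems(3) by (auto simp: bounded_iff)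
    have cb: "\<bar>c n\<bar> \<le> K * norm b / inner b b" for n
    proof -
      have "\<bar>inner (x n) b\<bar> \<le> norm (x n) * norm b" by (rule Cauchy_Schwarz_ineq2)
      also have "\<dots> \<le> K * norm b" using K by (intro mult_right_mono) auto
      finally show ?thesis by (simp add: c_def divide_right_mono)
    qed
    have "norm (y n) \<le> K + K * norm b / inner b b * norm b" for n
    proof -
      have "norm (y n) \<le> norm (x n) + \<bar>c n\<bar> * norm b"
        unfolding y_def using norm_triangle_ineq4[of "x n" "c n *\<^sub>R b"] by simp
      also have "\<dots> \<le> K + K * norm b / inner b b * norm b"
        using K cb by (intro add_mono mult_right_mono) auto
      finally show ?thesis .
    qed
    then have "bounded (range y)" by (auto simp: bounded_iff)
    moreover have "pairwise orthogonal C" using insert.prems(1) by (simp add: pairwise_insert)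
    ultimately obtain r1 l1 where r1: "strict_mono (r1 :: nat \<Rightarrow> nat)" "(y \<circ> r1) \<longlonglongrightarrow> l1"
      using insert.IH[of y] yC by blast
    have "bounded (range (c \<circ> r1))" using cb by (auto simp: bounded_iff)
    then obtain l2 r2 where r2: "strict_mono (r2 :: nat \<Rightarrow> nat)" "((c \<circ> r1) \<circ> r2) \<longlonglongrightarrow> l2"
      using bounded_imp_convergent_subsequence by blast
    have "((y \<circ> r1) \<circ> r2) \<longlonglongrightarrow> l1" using r1 r2 LIMSEQ_subseq_LIMSEQ by blast
    then have "(\<lambda>n. (y \<circ> r1 \<circ> r2) n + (c \<circ> r1 \<circ> r2) n *\<^sub>R b) \<longlonglongrightarrow> l1 + l2 *\<^sub>R b"
      by (intro tendsto_intros r2)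
    then have "(x \<circ> (r1 \<circ> r2)) \<longlonglongrightarrow> l1 + l2 *\<^sub>R b" by (simp add: y_def o_def)
    moreover have "strict_mono (r1 \<circ> r2)" using r1 r2 strict_mono_o by blast
    ultimately show ?thesis by blast
  qed
qed

section \<open>Left Fredholm operators on complex Hilbert spaces\<close>

context
  fixes sc :: "complex \<Rightarrow> 'v::{real_inner,complete_space} \<Rightarrow> 'v"
  assumes chs: "complex_hilbert_structure sc"
begin

lemma chs_vector_space: "vector_space sc"
  using chs by (simp add: complex_hilbert_structure_def module_iff_vector_space)

interpretation vector_space sc by (rule chs_vector_space)

lemma chs_of_real: "sc (complex_of_real r) x = r *\<^sub>R x"
  and chs_inner_i: "inner (sc \<i> x) (sc \<i> y) = inner x y"
  using chs by (auto simp: complex_hilbert_structure_def)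

lemma chs_Re_Im: "sc c x = Re c *\<^sub>R x + Im c *\<^sub>R sc \<i> x"
proof -
  have "sc c x = sc (complex_of_real (Re c) + complex_of_real (Im c) * \<i>) x"
    by (metis complex_eq mult.commute)
  also have "\<dots> = Re c *\<^sub>R x + Im c *\<^sub>R sc \<i> x"
    by (simp only: scale_left_distrib scale_scale[symmetric] chs_of_real)
  finally show ?thesis .
qed

lemma bounded_linear_chs: "bounded_linear (sc c)"
proof (rule bounded_linear_intro[where K = "\<bar>Re c\<bar> + \<bar>Im c\<bar>"])
  show "sc c (r *\<^sub>R x) = r *\<^sub>R sc c x" for r x
    by (simp add: chs_of_real[symmetric] mult.commute)
  fix x
  have "norm (sc \<i> x) = norm x" by (simp add: norm_eq_sqrt_inner chs_inner_i)
  then show "norm (sc c x) \<le> norm x * (\<bar>Re c\<bar> + \<bar>Im c\<bar>)"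
    unfolding chs_Re_Im[of c] using norm_triangle_ineq[of "Re c *\<^sub>R x" "Im c *\<^sub>R sc \<i> x"]
    by (simp add: algebra_simps)
qed (rule scale_right_distrib)

text \<open>In this context the bare \<open>subspace\<close> and \<open>span\<close> are the complex
  ones; the real ones carry the prefix \<open>real_vector\<close>.\<close>

lemma csubspace_iff_subspace: "csubspace sc V \<longleftrightarrow> subspace V"
proof
  assume "csubspace sc V"
  then show "subspace V"
    by (auto simp: csubspace_def subspace_def real_vector.subspace_def)
next
  assume V: "subspace V"
  then have "real_vector.subspace V"
    unfolding real_vector.subspace_def using chs_of_real
    by (metis subspace_0 subspace_add subspace_scale)
  then show "csubspace sc V" using V by (simp add: csubspace_def subspace_scale)
qed

text \<open>\<open>oproj\<close> is defined by real orthogonality. It is complex linear because M is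
  stable under multiplication by the imaginary unit, and hence so is its real orthogonal
  complement.\<close>

lemma linear_oproj:
  assumes M: "csubspace sc M" "closed M"
  shows "Vector_Spaces.linear sc sc (oproj M)"
proof -
  have rM: "real_vector.subspace M" using M by (simp add: csubspace_def)
  have cM: "\<And>c x. x \<in> M \<Longrightarrow> sc c x \<in> M" using M by (simp add: csubspace_def)
  show ?thesis unfolding Vector_Spaces.linear_iff
  proof (intro conjI allI chs_vector_space)
    show "oproj M (x + y) = oproj M x + oproj M y" for x y
      using bounded_linear_oproj[OF rM M(2)] by (simp add: linear_simps)
    fix c x
    show "oproj M (sc c x) = sc c (oproj M x)"
    proof (rule oproj_unique[OF rM M(2)])
      show "sc c (oproj M x) \<in> M" using cM oproj_in[OF rM M(2)] by blast
      fix m assume m: "m \<in> M"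
      \<comment> \<open>The adjoint of multiplication by \<open>\<i>\<close> is multiplication by
        \<open>- \<i>\<close>, which keeps \<open>m\<close> inside M.\<close>
      have "inner (sc \<i> u) m = inner u (sc (- \<i>) m)" for u
        using chs_inner_i[of u "sc (- \<i>) m"] by simp
      then have "inner (sc \<i> (x - oproj M x)) m = 0"
        using oproj_orth[OF rM M(2) cM[OF m]] by simp
      moreover have "inner (x - oproj M x) m = 0" using oproj_orth[OF rM M(2) m] .
      ultimately have "inner (sc c (x - oproj M x)) m = 0"
        by (subst chs_Re_Im) (simp add: inner_add)
      then show "inner (sc c x - sc c (oproj M x)) m = 0" by (simp add: scale_right_diff_distrib)
    qed
  qed
qed

lemma bop_oproj:
  assumes M: "csubspace sc M" "closed M" and MV: "M \<subseteq> V"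
  shows "bop sc V sc V (oproj M)"
proof -
  have rM: "real_vector.subspace M" using M by (simp add: csubspace_def)
  interpret p: Vector_Spaces.linear sc sc "oproj M" by (rule linear_oproj[OF M])
  obtain K where "\<And>x. norm (oproj M x) \<le> norm x * K"
    using bounded_linear.bounded[OF bounded_linear_oproj[OF rM M(2)]] by blast
  then show ?thesis unfolding bop_def
    using oproj_in[OF rM M(2)] MV by (auto simp: p.add p.scale mult.commute)
qed

lemma left_fredholm_iff_closed_range:
  assumes V: "csubspace sc V" and T: "Vector_Spaces.linear sc sc T" "T ` V \<subseteq> V"
  shows "left_fredholm sc V T \<longleftrightarrow> alpha_op sc V T < \<infinity> \<and> closed (ran_on V T)"
proof -
  interpret T: Vector_Spaces.linear sc sc T by fact
  have R: "csubspace sc (T ` V)"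
    using V T.subspace_image by (simp add: csubspace_iff_subspace)
  have "complemented_in sc V (T ` V)" if cl: "closed (T ` V)"
    unfolding complemented_in_def
  proof (intro exI[of _ "oproj (T ` V)"] conjI ballI)
    have rR: "real_vector.subspace (T ` V)" using R by (simp add: csubspace_def)
    note oi = oproj_in[OF rR cl] and od = oproj_id[OF rR cl]
    show "bop sc V sc V (oproj (T ` V))" by (rule bop_oproj[OF R cl T(2)])
    show "oproj (T ` V) (oproj (T ` V) x) = oproj (T ` V) x" for x by (rule od[OF oi])
    show "oproj (T ` V) ` V = T ` V"
    proof
      show "T ` V \<subseteq> oproj (T ` V) ` V"
      proof
        fix y assume "y \<in> T ` V"
        then show "y \<in> oproj (T ` V) ` V" using od[of y] T(2) by (metis image_eqI subsetD)
      qed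
    qed (use oi in auto)
  qed
  then show ?thesis by (auto simp: left_fredholm_def ran_on_def)
qed

text \<open>Makes a kernel of finite complex dimension accessible to the compactness argument over
  the reals. The real span is stable under \<open>\<i>\<close>, since applying it twice gives the
  negative.\<close>

lemma complex_span_subset_real_span: "span B \<subseteq> real_vector.span (B \<union> sc \<i> ` B)"
proof (rule span_minimal)
  let ?S = "real_vector.span (B \<union> sc \<i> ` B)"
  show "B \<subseteq> ?S" by (auto intro: real_vector.span_base)
  interpret i: bounded_linear "sc \<i>" by (rule bounded_linear_chs)
  have "sc \<i> x \<in> ?S" if "x \<in> ?S" for x
  proof -
    have "sc \<i> x \<in> real_vector.span (sc \<i> ` (B \<union> sc \<i> ` B))"
      using that linear_span_image[OF i.linear_axioms] by blast
    also have "\<dots> \<subseteq> ?S"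
    proof (rule real_vector.span_minimal)
      show "sc \<i> ` (B \<union> sc \<i> ` B) \<subseteq> ?S"
        by (auto intro: real_vector.span_base intro!: real_vector.span_neg)
    qed (rule real_vector.subspace_span)
    finally show ?thesis .
  qed
  then show "subspace ?S"
    unfolding subspace_def using chs_Re_Im
    by (metis real_vector.span_add real_vector.span_scale real_vector.span_zero)
qed

end

text \<open>A sequential formulation that mentions neither kernel nor range, and can therefore be
  checked coordinate by coordinate.\<close>

definition proper_on :: "'v::metric_space set \<Rightarrow> ('v \<Rightarrow> 'w::topological_space) \<Rightarrow> bool" where
  "proper_on V T \<longleftrightarrow>
    (\<forall>x::nat \<Rightarrow> 'v. (\<forall>n. x n \<in> V) \<and> bounded (range x) \<and> convergent (\<lambda>n. T (x n)) \<longrightarrow>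
       (\<exists>r::nat \<Rightarrow> nat. strict_mono r \<and> convergent (x \<circ> r)))"

lemma proper_onD:
  assumes "proper_on V T" "\<And>n. x n \<in> V" "bounded (range x)" "convergent (\<lambda>n. T (x n))"
  obtains r :: "nat \<Rightarrow> nat" where "strict_mono r" "convergent (x \<circ> r)"
  using assms unfolding proper_on_def by blast

lemma closed_ker_on:
  fixes T :: "'v::real_normed_vector \<Rightarrow> 'v"
  assumes "bounded_linear T" "closed V"
  shows "closed (ker_on V T)"
proof -
  have "continuous_on UNIV T" using assms(1) by (simp add: linear_continuous_on)
  then have "closed {x. T x = 0}" using continuous_closed_vimage[of "{0}" T]
    by (simp add: continuous_on_eq_continuous_at vimage_def)
  moreover have "ker_on V T = V \<inter> {x. T x = 0}" by (auto simp: ker_on_def)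
  ultimately show ?thesis using assms(2) by (simp add: closed_Int)
qed

text \<open>M is the orthogonal complement of the kernel within V. There T is injective with the
  same range, so closedness of the range becomes a question about lower bounds on M.\<close>

lemma orthogonal_complement_of_kernel:
  fixes T :: "'v::{real_inner,complete_space} \<Rightarrow> 'v"
  assumes T: "bounded_linear T" and V: "subspace V" "closed V"
  defines "M \<equiv> {x \<in> V. oproj (ker_on V T) x = 0}"
  shows "subspace M" "closed M" "T ` M = T ` V" "\<And>x. x \<in> M \<Longrightarrow> T x = 0 \<Longrightarrow> x = 0"
    "\<And>x. x \<in> V \<Longrightarrow> x - oproj (ker_on V T) x \<in> M" "\<And>x. T (oproj (ker_on V T) x) = 0"
    "bounded_linear (oproj (ker_on V T))"
proof -
  interpret T: bounded_linear T by fact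
  define K where "K = ker_on V T"
  have K: "closed K" unfolding K_def by (rule closed_ker_on[OF T V(2)])
  have sK: "subspace K"
    unfolding K_def using V(1) by (auto simp: subspace_def ker_on_def T.zero T.add T.scaleR)
  interpret P: bounded_linear "oproj K" by (rule bounded_linear_oproj[OF sK K])
  note oi = oproj_in[OF sK K] and od = oproj_id[OF sK K]
  have KV: "K \<subseteq> V" by (auto simp: K_def ker_on_def)
  have M: "M = ker_on V (oproj K)" by (auto simp: M_def K_def ker_on_def)
  show "subspace M"
    unfolding M using V(1) by (auto simp: subspace_def ker_on_def P.zero P.add P.scaleR)
  show "closed M" unfolding M by (rule closed_ker_on[OF P.bounded_linear_axioms V(2)])
  show TP: "T (oproj (ker_on V T) x) = 0" for x
    using oi[of x] by (simp add: K_def ker_on_def)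
  show inM: "x - oproj (ker_on V T) x \<in> M" if "x \<in> V" for x
  proof -
    have "x - oproj K x \<in> V" using that V(1) oi[of x] KV by (auto simp: subspace_diff)
    moreover have "oproj K (x - oproj K x) = 0" using od[OF oi[of x]] by (simp add: P.diff)
    ultimately show ?thesis by (simp add: M_def K_def)
  qed
  show "T ` M = T ` V"
  proof
    show "T ` V \<subseteq> T ` M"
    proof
      fix y assume "y \<in> T ` V"
      then obtain x where "x \<in> V" "y = T x" by blast
      then show "y \<in> T ` M" using inM[of x] TP[of x] by (intro image_eqI[of _ _ "x - oproj (ker_on V T) x"]) (auto simp: T.diff)
    qed
  qed (auto simp: M_def)
  show "x = 0" if "x \<in> M" "T x = 0" for x
    using that od[of x] by (auto simp: M_def K_def ker_on_def)
  show "bounded_linear (oproj (ker_on V T))" using P.bounded_linear_axioms by (simp add: K_def)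
qed

text \<open>Without a lower bound on M there are unit vectors of M whose images tend to 0;
  properness yields a limit which is a unit vector of M in the kernel, a contradiction. A lower
  bound makes the range complete.\<close>

lemma proper_on_imp_closed_range:
  fixes T :: "'v::{real_inner,complete_space} \<Rightarrow> 'v"
  assumes T: "bounded_linear T" and V: "subspace V" "closed V" and pr: "proper_on V T"
  shows "closed (T ` V)"
proof -
  interpret T: bounded_linear T by fact
  define M where "M = {x \<in> V. oproj (ker_on V T) x = 0}"
  note M = orthogonal_complement_of_kernel[OF T V, folded M_def]
  have "\<exists>c>0. \<forall>x\<in>M. c * norm x \<le> norm (T x)"
  proof (rule ccontr)
    assume neg: "\<not> ?thesis"
    have "\<exists>u\<in>M. norm u = 1 \<and> norm (T u) \<le> 1 / real (Suc n)" for n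
    proof -
      obtain x where x: "x \<in> M" "norm (T x) < 1 / real (Suc n) * norm x"
        using neg by (force simp: not_le dest!: spec[of _ "1 / real (Suc n)"])
      then have nz: "norm x > 0" by (cases "x = 0") (auto simp: T.zero)
      have "norm (T ((1 / norm x) *\<^sub>R x)) = norm (T x) / norm x" using nz by (simp add: T.scaleR)
      also have "\<dots> \<le> 1 / real (Suc n)" using x nz by (simp add: field_simps)
      finally show ?thesis using x nz M(1)
        by (intro bexI[of _ "(1 / norm x) *\<^sub>R x"]) (auto simp: subspace_scale)
    qed
    then obtain u where u: "\<And>n. u n \<in> M" "\<And>n. norm (u n) = 1" "\<And>n. norm (T (u n)) \<le> 1 / real (Suc n)"
      by metis
    have lim0: "(\<lambda>n. T (u n)) \<longlonglongrightarrow> 0"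
    proof (rule Lim_null_comparison)
      show "\<forall>\<^sub>F n in sequentially. norm (T (u n)) \<le> 1 / real (Suc n)" using u(3) by simp
      show "(\<lambda>n. 1 / real (Suc n)) \<longlonglongrightarrow> 0"
        using LIMSEQ_inverse_real_of_nat by (simp add: inverse_eq_divide)
    qed
    have uV: "u n \<in> V" for n using u(1) by (simp add: M_def)
    have "bounded (range u)" using u(2) by (auto simp: bounded_iff)
    with pr uV obtain r where r: "strict_mono (r :: nat \<Rightarrow> nat)" "convergent (u \<circ> r)"
      using lim0 by (elim proper_onD) (auto simp: convergent_def)
    then obtain l where l: "(u \<circ> r) \<longlonglongrightarrow> l" by (auto simp: convergent_def)
    have lM: "l \<in> M" using closed_sequentially[OF M(2) _ l] u(1) by simp
    have "(\<lambda>n. T ((u \<circ> r) n)) \<longlonglongrightarrow> T l" by (rule T.tendsto[OF l])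
    moreover have "(\<lambda>n. T ((u \<circ> r) n)) \<longlonglongrightarrow> 0"
      using LIMSEQ_subseq_LIMSEQ[OF lim0 r(1)] by (simp add: o_def)
    ultimately have "l = 0" using M(4)[OF lM] LIMSEQ_unique by blast
    moreover have "norm l = 1"
      using tendsto_norm[OF l] u(2) by (simp add: LIMSEQ_const_iff)
    ultimately show False by simp
  qed
  then obtain c where c: "c > 0" "\<forall>x\<in>M. c * norm x \<le> norm (T x)" by blast
  have "complete (T ` M)"
    using c M(1,2) by (intro complete_isometric_image[OF _ _ T]) (auto simp: complete_eq_closed)
  then show ?thesis using M(3) by (simp add: complete_eq_closed)
qed

text \<open>Each term splits into a part in M and a part in the kernel. The first parts form a
  Cauchy sequence by the lower bound on M, the second parts subconverge because the kernel is finite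
  dimensional.\<close>

lemma left_fredholm_imp_proper_on:
  fixes sc :: "complex \<Rightarrow> 'v::{real_inner,complete_space} \<Rightarrow> 'v"
  assumes chs: "complex_hilbert_structure sc" and V: "csubspace sc V" "closed V"
    and T: "Vector_Spaces.linear sc sc T" "bounded_linear T"
    and fin: "alpha_op sc V T < \<infinity>" and cl: "closed (T ` V)"
  shows "proper_on V T"
proof -
  interpret T: bounded_linear T by fact
  have rV: "subspace V" using V by (simp add: csubspace_def)
  define K where "K = ker_on V T"
  define M where "M = {x \<in> V. oproj K x = 0}"
  note M = orthogonal_complement_of_kernel[OF T(2) rV V(2), folded K_def, folded M_def]
  interpret P: bounded_linear "oproj K" by (rule M(7))
  have sK: "subspace K"
    unfolding K_def using rV by (auto simp: subspace_def ker_on_def T.zero T.add T.scaleR)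
  have K: "closed K" unfolding K_def by (rule closed_ker_on[OF T(2) V(2)])
  obtain c where c: "c > 0" "\<And>x. x \<in> M \<Longrightarrow> c * norm x \<le> norm (T x)"
    using bounded_below_if_closed_range[OF T(2) M(1,2)] M(3,4) cl by metis
  obtain B where B: "finite B" "module.span sc B = K"
    using fin by (auto simp: alpha_op_def cdim_def K_def split: if_splits)
  obtain C where C: "finite C" "span C = span (B \<union> sc \<i> ` B)" "pairwise orthogonal C"
    using basis_orthogonal[of "B \<union> sc \<i> ` B"] B(1) by auto
  have KC: "K \<subseteq> span C" using complex_span_subset_real_span[OF chs, of B] B C by simp
  show ?thesis unfolding proper_on_def
  proof (intro allI impI, elim conjE)
    fix x :: "nat \<Rightarrow> 'v"
    assume x: "\<forall>n. x n \<in> V" "bounded (range x)" "convergent (\<lambda>n. T (x n))"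
    define k where "k = (\<lambda>n. oproj K (x n))"
    define m where "m = (\<lambda>n. x n - k n)"
    have mM: "m n \<in> M" for n unfolding m_def k_def using M(5) x(1) by blast
    have Tm: "T (m n) = T (x n)" for n using M(6) by (simp add: m_def k_def T.diff)
    have "Cauchy m"
    proof (rule metric_CauchyI)
      fix e :: real assume e: "e > 0"
      have "Cauchy (\<lambda>n. T (x n))" using x(3) by (rule convergent_Cauchy)
      then obtain N where N: "\<And>i j. i \<ge> N \<Longrightarrow> j \<ge> N \<Longrightarrow> dist (T (x i)) (T (x j)) < c * e"
        using c(1) e by (meson metric_CauchyD mult_pos_pos)
      have "dist (m i) (m j) < e" if "i \<ge> N" "j \<ge> N" for i j
      proof -
        have "c * norm (m i - m j) \<le> norm (T (m i - m j))"
          using mM M(1) by (intro c(2)) (simp add: subspace_diff)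
        also have "\<dots> < c * e" using N[OF that] by (simp add: T.diff Tm dist_norm)
        finally show ?thesis using c(1) by (simp add: dist_norm)
      qed
      then show "\<exists>M. \<forall>i\<ge>M. \<forall>j\<ge>M. dist (m i) (m j) < e" by blast
    qed
    then obtain l where l: "m \<longlonglongrightarrow> l" using Cauchy_convergent convergent_def by blast
    have "bounded (range k)"
      using bounded_linear_image[OF x(2) M(7)] by (simp add: k_def image_image)
    moreover have "k n \<in> span C" for n using oproj_in[OF sK K] KC by (auto simp: k_def)
    ultimately obtain r l' where r: "strict_mono (r :: nat \<Rightarrow> nat)" "(k \<circ> r) \<longlonglongrightarrow> l'"
      using bounded_seq_in_orthogonal_span[OF C(1,3)] by blast
    have "(\<lambda>n. (m \<circ> r) n + (k \<circ> r) n) \<longlonglongrightarrow> l + l'"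
      by (intro tendsto_add r LIMSEQ_subseq_LIMSEQ[OF l])
    then have "(x \<circ> r) \<longlonglongrightarrow> l + l'" by (simp add: m_def o_def)
    then show "\<exists>r. strict_mono (r :: nat \<Rightarrow> nat) \<and> convergent (x \<circ> r)"
      using r(1) by (auto simp: convergent_def)
  qed
qed

section \<open>Upper triangular operators\<close>

lemma sum_enat_finite:
  fixes f :: "'b \<Rightarrow> enat"
  assumes "\<And>s. s \<in> A \<Longrightarrow> f s < \<infinity>"
  shows "sum f A < \<infinity>"
  using assms
proof (induction A rule: infinite_finite_induct)
  case (insert x F)
  then obtain i j where "f x = enat i" "sum f F = enat j"
    by (metis insertCI less_infinityE)
  then show ?case using insert by simp
qed (simp_all add: zero_enat_def)

text \<open>The spectra are defined through z - D, nullities and deficiencies through D - z.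
  Agreement up to sign is asked only on V, since the operators are prescribed only there.\<close>

lemma ker_ran_on_uminus_cong:
  assumes T: "Vector_Spaces.linear sc sc T" and V: "module.subspace sc V"
    and eq: "\<And>x. x \<in> V \<Longrightarrow> T' x = - T x"
  shows "ker_on V T' = ker_on V T" "ran_on V T' = ran_on V T"
proof -
  interpret T: Vector_Spaces.linear sc sc T by fact
  show "ker_on V T' = ker_on V T" using eq by (auto simp: ker_on_def)
  have neg: "- x \<in> V" if "x \<in> V" for x using that V T.vs1.subspace_neg by blast
  have "T' ` V = T ` V"
  proof
    show "T' ` V \<subseteq> T ` V" using eq neg by (auto simp: T.neg[symmetric])
    show "T ` V \<subseteq> T' ` V"
    proof
      fix y assume "y \<in> T ` V"
      then obtain x where "x \<in> V" "y = T x" by blast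
      then show "y \<in> T' ` V" using neg[of x] eq[of "- x"] by (intro image_eqI[of _ _ "- x"]) (auto simp: T.neg)
    qed
  qed
  then show "ran_on V T' = ran_on V T" by (simp add: ran_on_def)
qed

text \<open>\<open>bop\<close> constrains T on V alone. Composition with the projection onto V
  yields a linear bounded map on the whole space that agrees with T on V.\<close>

lemma linear_bop_oproj:
  fixes sc :: "complex \<Rightarrow> 'a::{real_inner,complete_space} \<Rightarrow> 'a"
  assumes chs: "complex_hilbert_structure sc" and V: "csubspace sc V" "closed V" and T: "bop sc V sc W T"
  shows "Vector_Spaces.linear sc sc (\<lambda>x. T (oproj V x))" "bounded_linear (\<lambda>x. T (oproj V x))"
    "\<And>x. x \<in> V \<Longrightarrow> T (oproj V x) = T x"
proof -
  have rV: "subspace V" using V by (simp add: csubspace_def)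
  interpret P: Vector_Spaces.linear sc sc "oproj V" by (rule linear_oproj[OF chs V])
  have PV: "oproj V x \<in> V" for x by (rule oproj_in[OF rV V(2)])
  show lin: "Vector_Spaces.linear sc sc (\<lambda>x. T (oproj V x))"
    unfolding Vector_Spaces.linear_iff using T PV P.vs1.vector_space_axioms
    by (auto simp: P.add P.scale bop_def)
  interpret L: Vector_Spaces.linear sc sc "\<lambda>x. T (oproj V x)" by (rule lin)
  obtain K where K: "\<And>x. x \<in> V \<Longrightarrow> norm (T x) \<le> K * norm x" using T unfolding bop_def by blast
  obtain K' where K': "\<And>x. norm (oproj V x) \<le> norm x * K'"
    using bounded_linear.bounded[OF bounded_linear_oproj[OF rV V(2)]] by blast
  show "bounded_linear (\<lambda>x. T (oproj V x))"
  proof (rule bounded_linear_intro[where K = "\<bar>K\<bar> * K'"])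
    fix x
    have "norm (T (oproj V x)) \<le> K * norm (oproj V x)" using K PV by blast
    \<comment> \<open>\<open>K\<close> may be negative when V is trivial.\<close>
    also have "\<dots> \<le> \<bar>K\<bar> * norm (oproj V x)" by (intro mult_right_mono) auto
    also have "\<dots> \<le> \<bar>K\<bar> * (norm x * K')" using K' by (intro mult_left_mono) auto
    finally show "norm (T (oproj V x)) \<le> norm x * (\<bar>K\<bar> * K')" by (simp add: ac_simps)
  next
    show "T (oproj V (r *\<^sub>R x)) = r *\<^sub>R T (oproj V x)" for r x
      using L.scale[of "complex_of_real r" x] by (simp add: chs_of_real[OF chs])
  qed (rule L.add)
  show "T (oproj V x) = T x" if "x \<in> V" for x using oproj_id[OF rV V(2) that] by simp
qed

lemma bop_minus_lam:
  fixes sc :: "complex \<Rightarrow> 'a::{real_inner,complete_space} \<Rightarrow> 'a"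
  assumes chs: "complex_hilbert_structure sc" and V: "csubspace sc V" and D: "bop sc V sc V D"
  shows "bop sc V sc V (minus_lam sc D z)"
proof -
  interpret vector_space sc by (rule chs_vector_space[OF chs])
  have sV: "subspace V" using V by (simp add: csubspace_iff_subspace[OF chs])
  obtain K where K: "\<And>x. x \<in> V \<Longrightarrow> norm (D x) \<le> K * norm x" using D unfolding bop_def by blast
  obtain K' where K': "\<And>x. norm (sc z x) \<le> norm x * K'"
    using bounded_linear.bounded[OF bounded_linear_chs[OF chs]] by blast
  have "norm (D x - sc z x) \<le> (K + K') * norm x" if "x \<in> V" for x
    using norm_triangle_ineq4[of "D x" "sc z x"] K[OF that] K'[of x] by (simp add: algebra_simps)
  moreover have "D x - sc z x \<in> V" if "x \<in> V" for x
    using that D sV by (auto simp: bop_def intro!: subspace_diff subspace_scale)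
  ultimately show ?thesis
    using D unfolding bop_def minus_lam_def
    by (auto simp: scale_right_distrib scale_right_diff_distrib scale_left_commute)
qed

section \<open>Direct sums and their truncations\<close>

lemma bounded_linear_componentwise:
  fixes f :: "'a::real_normed_vector \<Rightarrow> 'b::real_normed_vector ^ 'n::finite"
  assumes "\<And>i. bounded_linear (\<lambda>x. f x $ i)"
  shows "bounded_linear f"
proof -
  have "\<exists>K. \<forall>x. norm (f x $ i) \<le> norm x * K" for i
    using bounded_linear.bounded[OF assms] by blast
  then obtain K where K: "\<And>i x. norm (f x $ i) \<le> norm x * K i" by metis
  show ?thesis
  proof (rule bounded_linear_intro[where K = "\<Sum>i\<in>UNIV. K i"])
    fix x
    have "norm (f x) \<le> (\<Sum>i\<in>UNIV. norm (f x $ i))" unfolding norm_vec_def by (rule L2_set_le_sum) simp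
    also have "\<dots> \<le> (\<Sum>i\<in>UNIV. norm x * K i)" by (intro sum_mono K)
    finally show "norm (f x) \<le> norm x * (\<Sum>i\<in>UNIV. K i)" by (simp add: sum_distrib_left)
  qed (simp_all add: vec_eq_iff linear_simps[OF assms])
qed

lemma complex_hilbert_structure_dsc:
  fixes sc :: "complex \<Rightarrow> 'a::{real_inner,complete_space} \<Rightarrow> 'a"
  assumes chs: "complex_hilbert_structure sc"
  shows "complex_hilbert_structure (dsc sc :: complex \<Rightarrow> 'a ^ 'n::finite \<Rightarrow> 'a ^ 'n)"
proof -
  interpret vector_space sc by (rule chs_vector_space[OF chs])
  show ?thesis
    unfolding complex_hilbert_structure_def module_def
    by (auto simp: dsc_def vec_eq_iff scale_right_distrib scale_left_distrib chs_of_real[OF chs]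
        inner_vec_def chs_inner_i[OF chs])
qed

text \<open>Partial direct sums are kept inside the full one as vectors supported on J. All
  truncations are then restrictions of the same T to subspaces of one space.\<close>

definition dsum_on :: "('n::finite \<Rightarrow> 'a::zero set) \<Rightarrow> 'n set \<Rightarrow> ('a ^ 'n) set" where
  "dsum_on X J = {x \<in> dsum X. \<forall>k. k \<notin> J \<longrightarrow> x $ k = 0}"

locale upper_triangular =
  fixes sc :: "complex \<Rightarrow> 'a::{real_inner,complete_space} \<Rightarrow> 'a"
    and X :: "'n::{finite,linorder} \<Rightarrow> 'a set"
    and E :: "'n \<Rightarrow> 'a \<Rightarrow> 'a" and A :: "'n \<Rightarrow> 'n \<Rightarrow> 'a \<Rightarrow> 'a"
  assumes chs: "complex_hilbert_structure sc"
    and X: "csubspace sc (X k)" "closed (X k)"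
    and E_linear: "Vector_Spaces.linear sc sc (E k)" and E_bounded: "bounded_linear (E k)"
    and E_in: "x \<in> X k \<Longrightarrow> E k x \<in> X k"
    and A_linear: "i < j \<Longrightarrow> Vector_Spaces.linear sc sc (A i j)"
    and A_bounded: "i < j \<Longrightarrow> bounded_linear (A i j)"
    and A_in: "i < j \<Longrightarrow> x \<in> X j \<Longrightarrow> A i j x \<in> X i"
begin

sublocale vector_space sc by (rule chs_vector_space[OF chs])

sublocale d: vector_space "dsc sc :: complex \<Rightarrow> ('a, 'n) vec \<Rightarrow> ('a, 'n) vec"
  by (rule chs_vector_space[OF complex_hilbert_structure_dsc[OF chs]])

abbreviation T :: "('a, 'n) vec \<Rightarrow> ('a, 'n) vec" where "T \<equiv> Tnd E A"

lemma T_nth: "T x $ i = E i (x $ i) + (\<Sum>j\<in>{j. i < j}. A i j (x $ j))"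
  by (simp add: Tnd_def)

lemma E_zero: "E i 0 = 0" and A_zero: "i < j \<Longrightarrow> A i j 0 = 0"
  using E_bounded A_bounded by (auto simp: linear_simps)

lemma X_subspace: "subspace (X k)"
  using X csubspace_iff_subspace[OF chs] by blast

lemma dsum_subspace: "d.subspace (dsum X)"
  using X_subspace by (auto simp: d.subspace_def dsum_def dsc_def subspace_def)

lemma dsum_on_subspace: "d.subspace (dsum_on X J)"
  using dsum_subspace by (auto simp: d.subspace_def dsum_on_def dsc_def)

lemma dsum_csubspace: "csubspace (dsc sc) (dsum X)"
  using dsum_subspace csubspace_iff_subspace[OF complex_hilbert_structure_dsc[OF chs]] by blast

lemma dsum_on_UNIV: "dsum_on X UNIV = dsum X"
  by (simp add: dsum_on_def)

lemma dsum_on_empty: "dsum_on X {} = {0}"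
  using X_subspace by (auto simp: dsum_on_def dsum_def vec_eq_iff subspace_0)

lemma dsum_closed: "closed (dsum X)"
  unfolding closed_sequential_limits
proof (intro allI impI, elim conjE)
  fix x l assume x: "\<forall>n. x n \<in> dsum X" and l: "x \<longlonglongrightarrow> l"
  have "l $ k \<in> X k" for k
    using x by (intro closed_sequentially[OF X(2) _ tendsto_vec_nth[OF l]]) (auto simp: dsum_def)
  then show "l \<in> dsum X" by (simp add: dsum_def)
qed

lemma axis_dsum: "y \<in> X m \<Longrightarrow> m \<in> J \<Longrightarrow> axis m y \<in> dsum_on X J"
  using X_subspace by (auto simp: dsum_on_def dsum_def axis_def subspace_0)

lemma T_linear: "Vector_Spaces.linear (dsc sc) (dsc sc) T"
  unfolding Vector_Spaces.linear_iff
proof (intro conjI allI d.vector_space_axioms)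
  have A: "A i j (x + y) = A i j x + A i j y" "A i j (sc c x) = sc c (A i j x)" if "i < j" for i j x y c
    using A_linear[OF that] by (auto simp: Vector_Spaces.linear_iff)
  have E: "E i (x + y) = E i x + E i y" "E i (sc c x) = sc c (E i x)" for i x y c
    using E_linear by (auto simp: Vector_Spaces.linear_iff)
  show "T (x + y) = T x + T y" for x y
    by (simp add: vec_eq_iff T_nth A E sum.distrib)
  show "T (dsc sc c x) = dsc sc c (T x)" for c x
    by (simp add: vec_eq_iff T_nth dsc_def A E scale_right_distrib scale_sum_right)
qed

lemma T_bounded: "bounded_linear T"
proof (rule bounded_linear_componentwise)
  fix i
  have "bounded_linear (\<lambda>x :: ('a, 'n) vec. E i (x $ i) + (\<Sum>j\<in>{j. i < j}. A i j (x $ j)))"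
    by (intro bounded_linear_add bounded_linear_sum)
      (auto intro: bounded_linear_compose[OF E_bounded bounded_linear_vec_nth]
        bounded_linear_compose[OF A_bounded bounded_linear_vec_nth])
  then show "bounded_linear (\<lambda>x. T x $ i)" by (simp add: T_nth)
qed

lemma nth_linear: "Vector_Spaces.linear (dsc sc) sc (\<lambda>x :: ('a, 'n) vec. x $ m)"
  unfolding Vector_Spaces.linear_iff by (auto simp: dsc_def vector_space_axioms d.vector_space_axioms)

lemma T_in_dsum: "x \<in> dsum X \<Longrightarrow> T x \<in> dsum X"
  using X_subspace E_in A_in by (auto simp: dsum_def T_nth intro!: subspace_add subspace_sum)

lemma T_in_dsum_on:
  assumes J: "\<And>i j. j \<in> J \<Longrightarrow> i < j \<Longrightarrow> i \<in> J" and x: "x \<in> dsum_on X J"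
  shows "T x \<in> dsum_on X J"
proof -
  have "T x $ i = 0" if "i \<notin> J" for i
  proof -
    have "x $ j = 0" if "i < j" for j using that \<open>i \<notin> J\<close> J x by (auto simp: dsum_on_def)
    moreover have "x $ i = 0" using \<open>i \<notin> J\<close> x by (simp add: dsum_on_def)
    ultimately show ?thesis by (simp add: T_nth E_zero A_zero)
  qed
  then show ?thesis using x T_in_dsum by (auto simp: dsum_on_def)
qed

text \<open>The last row of a truncation has only its diagonal entry, so the coordinate
  \<open>m\<close> intertwines T with \<open>E m\<close>. This is the commutation required by the
  kernel-cokernel sequence.\<close>

lemma T_nth_top:
  assumes J: "\<forall>a\<in>J. a < m" and x: "x \<in> dsum_on X (insert m J)"
  shows "T x $ m = E m (x $ m)"
proof -
  have "x $ j = 0" if "m < j" for j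
  proof -
    have "j \<notin> insert m J" using that J by (metis insertE order.asym order.irrefl)
    then show ?thesis using x by (simp add: dsum_on_def)
  qed
  then show ?thesis by (simp add: T_nth A_zero)
qed

lemma dsum_on_step:
  assumes J: "\<forall>a\<in>J. a < m"
  shows "dsum_on X J = {x \<in> dsum_on X (insert m J). x $ m = 0}" "(\<lambda>x. x $ m) ` dsum_on X (insert m J) = X m"
proof -
  have "m \<notin> J" using J by auto
  then have "(\<forall>k. k \<notin> J \<longrightarrow> x $ k = 0) \<longleftrightarrow> (\<forall>k. k \<notin> insert m J \<longrightarrow> x $ k = 0) \<and> x $ m = 0"
    for x :: "('a, 'n) vec" by (metis insert_iff)
  then show "dsum_on X J = {x \<in> dsum_on X (insert m J). x $ m = 0}" unfolding dsum_on_def by blast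
  show "(\<lambda>x. x $ m) ` dsum_on X (insert m J) = X m"
  proof
    show "X m \<subseteq> (\<lambda>x. x $ m) ` dsum_on X (insert m J)"
    proof
      fix y assume "y \<in> X m"
      then show "y \<in> (\<lambda>x. x $ m) ` dsum_on X (insert m J)"
        using axis_dsum[of y m "insert m J"] by (intro image_eqI[of _ _ "axis m y"]) (simp_all add: axis_def)
    qed
  qed (auto simp: dsum_on_def dsum_def)
qed

section \<open>Nullities and deficiencies of the truncations\<close>

abbreviation "a k \<equiv> alpha_op sc (X k) (E k)"
abbreviation "b k \<equiv> beta_op sc (X k) (E k)"
abbreviation "aT J \<equiv> alpha_op (dsc sc) (dsum_on X J) T"
abbreviation "bT J \<equiv> beta_op (dsc sc) (dsum_on X J) T"

lemma T_image_dsum_on: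
  assumes "\<And>i j. j \<in> J \<Longrightarrow> i < j \<Longrightarrow> i \<in> J"
  shows "T ` dsum_on X J \<subseteq> dsum_on X J"
  using T_in_dsum_on assms by blast

lemma kernel_cokernel_step:
  assumes down: "\<And>i j. j \<in> insert m J \<Longrightarrow> i < j \<Longrightarrow> i \<in> insert m J" and top: "\<forall>s\<in>J. s < m"
  shows "aT J + a m + bT (insert m J) = aT (insert m J) + bT J + b m"
    and "aT (insert m J) \<le> aT J + a m"
    and "a m \<le> aT (insert m J) + bT J"
  using kernel_cokernel_sequence[OF T_linear E_linear nth_linear dsum_on_subspace T_image_dsum_on[OF down]
      T_nth_top[OF top] dsum_on_step(1)[OF top] dsum_on_step(2)[OF top, symmetric]]
  by auto

lemma index_empty: "aT {} = 0" "bT {} = 0"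
proof -
  have T0: "T 0 = 0" using T_bounded by (simp add: linear_simps)
  have "ker_on (dsum_on X {}) T = {0}" by (auto simp: dsum_on_empty ker_on_def T0)
  moreover have "ccodim (dsc sc) {0} {0 :: ('a, 'n) vec} = 0"
    using ccodim_le_card[of "{}" "{0 :: ('a, 'n) vec}" "dsc sc" "{0}"] by (simp add: zero_enat_def[symmetric])
  moreover have "aT {} = ccodim (dsc sc) {0} (ker_on (dsum_on X {}) T)"
    by (rule alpha_op_eq_ccodim[OF T_linear dsum_on_subspace])
  ultimately show "aT {} = 0" "bT {} = 0"
    by (simp_all add: beta_op_def ran_on_def dsum_on_empty T0)
qed

text \<open>Additivity of the index in subtraction-free form; the deficiencies may be infinite. The
  bound on \<open>aT J\<close> is carried along because it makes \<open>aT J\<close> finite, which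
  the induction needs for a cancellation.\<close>

lemma index_sum:
  assumes "\<And>i j. j \<in> J \<Longrightarrow> i < j \<Longrightarrow> i \<in> J" "\<And>s. s \<in> J \<Longrightarrow> a s < \<infinity>"
  shows "(\<Sum>s\<in>J. a s) + bT J = aT J + (\<Sum>s\<in>J. b s) \<and> aT J \<le> (\<Sum>s\<in>J. a s)"
proof -
  have "finite J" by simp
  then show ?thesis using assms
  proof (induction rule: finite_linorder_max_induct)
    case empty
    show ?case by (simp add: index_empty)
  next
    case (insert m J)
    have down: "i \<in> J" if "j \<in> J" "i < j" for i j
      using insert.hyps insert.prems(1)[of j i] that by (metis insertE insertI2 order.asym)
    have IH: "(\<Sum>s\<in>J. a s) + bT J = aT J + (\<Sum>s\<in>J. b s)" "aT J \<le> (\<Sum>s\<in>J. a s)"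
      using insert.IH down insert.prems(2) by auto
    have m: "m \<notin> J" using insert.hyps by auto
    note step = kernel_cokernel_step[OF insert.prems(1) insert.hyps(2)]
    have fin: "(\<Sum>s\<in>J. a s) < \<infinity>" using insert.prems(2) by (intro sum_enat_finite) auto
    then have finT: "aT J \<noteq> \<infinity>" using IH(2) by (cases "aT J") auto
    \<comment> \<open>Both sides are padded with \<open>aT J\<close>, which is finite and cancels at
      the end; the possibly infinite \<open>bT J\<close> is removed by substituting
      \<open>IH(1)\<close> instead.\<close>
    have "aT J + ((\<Sum>s\<in>insert m J. a s) + bT (insert m J))
        = (\<Sum>s\<in>J. a s) + (aT J + a m + bT (insert m J))" using m by (simp add: ac_simps)
    also have "\<dots> = (\<Sum>s\<in>J. a s) + (aT (insert m J) + bT J + b m)" using step(1) by simp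
    also have "\<dots> = ((\<Sum>s\<in>J. a s) + bT J) + aT (insert m J) + b m" by (simp add: ac_simps)
    also have "\<dots> = aT J + (aT (insert m J) + (\<Sum>s\<in>insert m J. b s))"
      unfolding IH(1) using m by (simp add: ac_simps)
    finally have 1: "(\<Sum>s\<in>insert m J. a s) + bT (insert m J) = aT (insert m J) + (\<Sum>s\<in>insert m J. b s)"
      using finT by (simp add: enat_add_left_cancel)
    have "aT (insert m J) \<le> aT J + a m" using step(2) by simp
    also have "\<dots> \<le> (\<Sum>s\<in>insert m J. a s)" using IH(2) m by (simp add: add.commute add_left_mono)
    finally show ?case using 1 by blast
  qed
qed

text \<open>The largest index comes first: its coordinate subconverges through \<open>E m\<close>,
  and subtracting that coordinate leaves a sequence supported on J whose images still
  converge.\<close>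

lemma proper_on_T:
  assumes "\<And>i j. j \<in> J \<Longrightarrow> i < j \<Longrightarrow> i \<in> J" "\<And>s. s \<in> J \<Longrightarrow> proper_on (X s) (E s)"
  shows "proper_on (dsum_on X J) T"
proof -
  have "finite J" by simp
  then show ?thesis using assms
  proof (induction rule: finite_linorder_max_induct)
    case empty
    show ?case unfolding proper_on_def dsum_on_empty
    proof (intro allI impI, elim conjE)
      fix x :: "nat \<Rightarrow> ('a, 'n) vec" assume "\<forall>n. x n \<in> {0}"
      then show "\<exists>r. strict_mono (r :: nat \<Rightarrow> nat) \<and> convergent (x \<circ> r)"
        by (intro exI[of _ id]) (auto simp: strict_mono_def o_def convergent_const)
    qed
  next
    case (insert m J)
    have down: "i \<in> J" if "j \<in> J" "i < j" for i j
      using insert.hyps insert.prems(1)[of j i] that by (metis insertE insertI2 order.asym)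
    have IH: "proper_on (dsum_on X J) T" using insert.IH down insert.prems(2) by auto
    show ?case unfolding proper_on_def
    proof (intro allI impI, elim conjE)
      fix x :: "nat \<Rightarrow> ('a, 'n) vec"
      assume x: "\<forall>n. x n \<in> dsum_on X (insert m J)" "bounded (range x)" "convergent (\<lambda>n. T (x n))"
      define y where "y = (\<lambda>n. x n $ m)"
      obtain l0 where l0: "(\<lambda>n. T (x n)) \<longlonglongrightarrow> l0" using x(3) by (auto simp: convergent_def)
      have "bounded (range y)"
        using bounded_linear_image[OF x(2) bounded_linear_vec_nth[of m]] by (simp add: y_def image_image)
      moreover have yX: "y n \<in> X m" for n using x(1) by (auto simp: y_def dsum_on_def dsum_def)
      moreover have "convergent (\<lambda>n. E m (y n))"
        using tendsto_vec_nth[OF l0, of m] x(1) T_nth_top[OF insert.hyps(2)]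
        by (auto simp: y_def convergent_def)
      ultimately obtain r1 where r1: "strict_mono (r1 :: nat \<Rightarrow> nat)" "convergent (y \<circ> r1)"
        using insert.prems(2)[of m] proper_onD by blast
      then obtain l1 where l1: "(y \<circ> r1) \<longlonglongrightarrow> l1" by (auto simp: convergent_def)
      define w where "w = (\<lambda>n. axis m (y (r1 n)) :: ('a, 'n) vec)"
      have w: "w \<longlonglongrightarrow> axis m l1"
        using l1 unfolding w_def by (intro vec_tendstoI) (auto simp: axis_def o_def)
      have wW: "w n \<in> dsum_on X (insert m J)" for n
        by (simp add: w_def axis_dsum yX)
      define v where "v = (\<lambda>n. x (r1 n) - w n)"
      have vJ: "v n \<in> dsum_on X J" for n
      proof -
        have "v n \<in> dsum_on X (insert m J)"
          unfolding v_def using x(1) wW by (intro d.subspace_diff dsum_on_subspace) auto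
        moreover have "v n $ m = 0" by (simp add: v_def w_def y_def)
        ultimately show ?thesis using dsum_on_step(1)[OF insert.hyps(2)] by blast
      qed
      have "bounded (range (x \<circ> r1))" using x(2) by (rule bounded_subset) auto
      moreover have "bounded (range w)" using w convergent_imp_bounded by blast
      ultimately have "bounded (range v)"
        using bounded_minus_comp[of "x \<circ> r1" UNIV w] by (simp add: v_def o_def)
      moreover have "convergent (\<lambda>n. T (v n))"
      proof (rule convergentI)
        have "T (v n) = (T \<circ> x \<circ> r1) n - T (w n)" for n
          using T_bounded by (simp add: v_def linear_simps)
        moreover have "(\<lambda>n. (T \<circ> x \<circ> r1) n - T (w n)) \<longlonglongrightarrow> l0 - T (axis m l1)"
          using LIMSEQ_subseq_LIMSEQ[OF l0 r1(1)]
          by (intro tendsto_diff bounded_linear.tendsto[OF T_bounded w]) (simp add: o_def)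
        ultimately show "(\<lambda>n. T (v n)) \<longlonglongrightarrow> l0 - T (axis m l1)" by simp
      qed
      ultimately obtain r2 where r2: "strict_mono (r2 :: nat \<Rightarrow> nat)" "convergent (v \<circ> r2)"
        by (rule proper_onD[OF IH vJ])
      then obtain l2 where l2: "(v \<circ> r2) \<longlonglongrightarrow> l2" by (auto simp: convergent_def)
      have "(\<lambda>n. (v \<circ> r2) n + (w \<circ> r2) n) \<longlonglongrightarrow> l2 + axis m l1"
        by (intro tendsto_add l2 LIMSEQ_subseq_LIMSEQ[OF w r2(1)])
      then have "(x \<circ> (r1 \<circ> r2)) \<longlonglongrightarrow> l2 + axis m l1" by (simp add: v_def o_def)
      moreover have "strict_mono (r1 \<circ> r2)" using r1 r2 strict_mono_o by blast
      ultimately show "\<exists>r. strict_mono (r :: nat \<Rightarrow> nat) \<and> convergent (x \<circ> r)"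
        by (auto simp: convergent_def)
    qed
  qed
qed

lemma aT_mono: "J \<subseteq> J' \<Longrightarrow> aT J \<le> aT J'"
  by (intro alpha_op_mono T_linear dsum_on_subspace) (auto simp: dsum_on_def)

lemma closed_range_T:
  assumes "\<And>s. a s < \<infinity>" "\<And>s. closed (ran_on (X s) (E s))"
  shows "closed (ran_on (dsum X) T)"
proof -
  have "proper_on (X s) (E s)" for s
    using left_fredholm_imp_proper_on[OF chs X E_linear E_bounded] assms by (simp add: ran_on_def)
  then have "proper_on (dsum X) T" using proper_on_T[of UNIV] by (simp add: dsum_on_UNIV)
  then show ?thesis unfolding ran_on_def
    using proper_on_imp_closed_range[OF T_bounded _ dsum_closed] dsum_csubspace by (simp add: csubspace_def)
qed

text \<open>For the least index, T maps \<open>axis m y\<close> to \<open>axis m (E m y)\<close>, so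
  \<open>E m\<close> is a restriction of T and inherits its properness.\<close>

lemma first_entry_left_fredholm:
  assumes fin: "alpha_op (dsc sc) (dsum X) T < \<infinity>" and cl: "closed (ran_on (dsum X) T)"
    and m: "\<And>i. m \<le> i"
  shows "a m < \<infinity>" "closed (ran_on (X m) (E m))"
proof -
  have "i \<in> {m}" if "j \<in> {m}" "i < j" for i j using that m[of i] by auto
  \<comment> \<open>The truncation below \<open>m\<close> is empty and has deficiency 0, so the
    bound reduces to the nullity of T on the first summand.\<close>
  then have "a m \<le> aT {m} + bT {}"
    using kernel_cokernel_step(3)[of m "{}"] by simp
  also have "\<dots> \<le> aT UNIV" using aT_mono[of "{m}" UNIV] by (simp add: index_empty)
  finally show "a m < \<infinity>" using fin unfolding dsum_on_UNIV by (rule le_less_trans)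
  have pT: "proper_on (dsum X) T"
    using left_fredholm_imp_proper_on[OF complex_hilbert_structure_dsc[OF chs] dsum_csubspace dsum_closed
        T_linear T_bounded fin] cl by (simp add: ran_on_def)
  have T_axis: "T (axis m y) = axis m (E m y)" for y
  proof -
    have "m < j \<Longrightarrow> axis m y $ j = 0" "i < j \<Longrightarrow> axis m y $ j = 0" for i j
      using m[of i] by (auto simp: axis_def)
    then show ?thesis by (auto simp: vec_eq_iff T_nth A_zero E_zero axis_def)
  qed
  have "proper_on (X m) (E m)" unfolding proper_on_def
  proof (intro allI impI, elim conjE)
    fix y :: "nat \<Rightarrow> 'a"
    assume y: "\<forall>n. y n \<in> X m" "bounded (range y)" "convergent (\<lambda>n. E m (y n))"
    then obtain l where l: "(\<lambda>n. E m (y n)) \<longlonglongrightarrow> l" by (auto simp: convergent_def)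
    have "(\<lambda>n. T (axis m (y n))) \<longlonglongrightarrow> axis m l"
      unfolding T_axis using l by (intro vec_tendstoI) (auto simp: axis_def)
    then have lim: "convergent (\<lambda>n. T (axis m (y n)))" by (rule convergentI)
    have "bounded_linear (\<lambda>u. axis m u $ i :: 'a)" for i :: 'n
      by (cases "i = m") (simp_all add: axis_def bounded_linear_ident bounded_linear_zero)
    then have "bounded_linear (axis m :: 'a \<Rightarrow> ('a, 'n) vec)" by (rule bounded_linear_componentwise)
    then have bdd: "bounded (range (\<lambda>n. axis m (y n) :: ('a, 'n) vec))"
      using bounded_linear_image[OF y(2)] by (simp add: image_image)
    have inX: "axis m (y n) \<in> dsum X" for n using axis_dsum[of "y n" m UNIV] y(1) by (simp add: dsum_on_UNIV)
    obtain r where r: "strict_mono (r :: nat \<Rightarrow> nat)" "convergent ((\<lambda>n. axis m (y n)) \<circ> r :: nat \<Rightarrow> ('a, 'n) vec)"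
      by (rule proper_onD[OF pT inX bdd lim])
    then obtain l' where "((\<lambda>n. axis m (y n)) \<circ> r :: nat \<Rightarrow> ('a, 'n) vec) \<longlonglongrightarrow> l'" by (auto simp: convergent_def)
    from tendsto_vec_nth[OF this, of m] have "(y \<circ> r) \<longlonglongrightarrow> l' $ m" by (simp add: o_def)
    then show "\<exists>r. strict_mono (r :: nat \<Rightarrow> nat) \<and> convergent (y \<circ> r)" using r(1) by (auto simp: convergent_def)
  qed
  then show "closed (ran_on (X m) (E m))"
    unfolding ran_on_def using proper_on_imp_closed_range[OF E_bounded _ X(2)] X(1) by (simp add: csubspace_def)
qed

text \<open>Up to the finite dimensional kernel of T, the kernel of \<open>E k\<close> embeds into
  the cokernel of the truncation below \<open>k\<close>, whose deficiency is therefore infinite.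
  Nullities below \<open>k\<close> are finite, so \<open>index_sum\<close> passes this on to the sum
  of the deficiencies.\<close>

lemma beta_sum_infinite:
  assumes fin: "alpha_op (dsc sc) (dsum X) T < \<infinity>" and k: "a k = \<infinity>" and less: "\<And>s. s < k \<Longrightarrow> a s < \<infinity>"
  shows "(\<Sum>s\<in>{s. s < k}. b s) = \<infinity>"
proof -
  define J where "J = {s. s < k}"
  have dJ: "i \<in> J" if "j \<in> J" "i < j" for i j using that by (auto simp: J_def)
  have dkJ: "i \<in> insert k J" if "j \<in> insert k J" "i < j" for i j using that by (auto simp: J_def)
  have top: "\<forall>s\<in>J. s < k" by (simp add: J_def)
  have "a k \<le> aT (insert k J) + bT J"
    by (rule kernel_cokernel_step(3)[OF dkJ top])
  moreover have "aT (insert k J) < \<infinity>"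
    using aT_mono[OF subset_UNIV, of "insert k J"] fin unfolding dsum_on_UNIV by (rule le_less_trans)
  ultimately have "bT J = \<infinity>" using k by (cases "bT J"; cases "aT (insert k J)") auto
  then have "aT J + (\<Sum>s\<in>J. b s) = \<infinity>" using index_sum[of J, OF dJ] less by (auto simp: J_def)
  moreover have "aT J < \<infinity>" using aT_mono[OF subset_UNIV, of J] fin unfolding dsum_on_UNIV by (rule le_less_trans)
  ultimately show ?thesis by (auto simp: plus_eq_infty_iff_enat J_def)
qed

lemma left_weyl_iff:
  "left_weyl sc (X k) (E k) \<longleftrightarrow> a k < \<infinity> \<and> closed (ran_on (X k) (E k)) \<and> a k \<le> b k"
proof -
  have "E k ` X k \<subseteq> X k" using E_in by blast
  from left_fredholm_iff_closed_range[OF chs X(1) E_linear this] show ?thesis by (auto simp: left_weyl_def)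
qed

lemma left_weyl_T_iff:
  "left_weyl (dsc sc) (dsum X) T \<longleftrightarrow> aT UNIV < \<infinity> \<and> closed (ran_on (dsum X) T) \<and> aT UNIV \<le> bT UNIV"
proof -
  have "T ` dsum X \<subseteq> dsum X" using T_in_dsum by blast
  from left_fredholm_iff_closed_range[OF complex_hilbert_structure_dsc[OF chs] dsum_csubspace T_linear this]
  show ?thesis by (auto simp: left_weyl_def dsum_on_UNIV)
qed

end

section \<open>The equality of spectra at a fixed point z\<close>

lemma left_weyl_uminus_cong:
  assumes T: "Vector_Spaces.linear sc sc T" and V: "module.subspace sc V"
    and eq: "\<And>x. x \<in> V \<Longrightarrow> T' x = - T x"
  shows "left_weyl sc V T' \<longleftrightarrow> left_weyl sc V T" "left_fredholm sc V T' \<longleftrightarrow> left_fredholm sc V T"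
  using ker_ran_on_uminus_cong[OF assms]
  by (simp_all add: left_weyl_def left_fredholm_def alpha_op_def beta_op_def)

context upper_triangular begin

lemma not_left_weyl_cases:
  "(\<exists>k. \<not> left_weyl sc (X k) (E k)) \<longleftrightarrow>
     \<not> left_weyl (dsc sc) (dsum X) T
   \<or> ((\<exists>k. k \<noteq> Min UNIV \<and> a k = \<infinity> \<and> (\<forall>s. Min UNIV < s \<and> s < k \<longrightarrow> a s < \<infinity>)
          \<and> (\<Sum>s\<in>{s. s < k}. b s) = \<infinity>)
       \<and> left_fredholm sc (X (Min UNIV)) (E (Min UNIV)) \<and> (\<Sum>s\<in>UNIV. a s) \<le> (\<Sum>s\<in>UNIV. b s))
   \<or> (\<exists>k. (\<forall>s. a s < \<infinity>) \<and> (\<Sum>s\<in>UNIV. a s) \<le> (\<Sum>s\<in>UNIV. b s)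
          \<and> (b k < a k \<or> \<not> closed (ran_on (X k) (E k))))"
  (is "?L \<longleftrightarrow> ?W \<or> ?D1 \<or> ?D2")
proof
  assume L: ?L
  show "?W \<or> ?D1 \<or> ?D2"
  proof (rule disjCI)
    assume nD: "\<not> (?D1 \<or> ?D2)"
    show ?W
    proof
      assume W: "left_weyl (dsc sc) (dsum X) T"
      then have fin: "alpha_op (dsc sc) (dsum X) T < \<infinity>" and cl: "closed (ran_on (dsum X) T)"
        and le: "aT UNIV \<le> bT UNIV"
        by (simp_all add: left_weyl_T_iff dsum_on_UNIV)
      have min: "Min UNIV \<le> i" for i :: 'n by simp
      note first = first_entry_left_fredholm[OF fin cl min]
      have EX: "E (Min UNIV) ` X (Min UNIV) \<subseteq> X (Min UNIV)" using E_in by blast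
      have first': "left_fredholm sc (X (Min UNIV)) (E (Min UNIV))"
        using first left_fredholm_iff_closed_range[OF chs X(1) E_linear EX] by blast
      show False
      proof (cases "\<forall>s. a s < \<infinity>")
        case True
        have id: "(\<Sum>s\<in>UNIV. a s) + bT UNIV = aT UNIV + (\<Sum>s\<in>UNIV. b s)"
          using index_sum[of UNIV] True by simp
        have "(\<Sum>s\<in>UNIV. a s) \<le> (\<Sum>s\<in>UNIV. b s)"
        proof (cases "bT UNIV = \<infinity>")
          case True
          then have "aT UNIV + (\<Sum>s\<in>UNIV. b s) = \<infinity>" using id by simp
          then have "(\<Sum>s\<in>UNIV. b s) = \<infinity>" using fin by (auto simp: plus_eq_infty_iff_enat dsum_on_UNIV)
          then show ?thesis by simp
        next
          case False
          \<comment> \<open>The inequality for T is inserted into the index identity;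
            \<open>bT UNIV\<close> is finite in this case and can be cancelled.\<close>
          have "(\<Sum>s\<in>UNIV. a s) + bT UNIV \<le> bT UNIV + (\<Sum>s\<in>UNIV. b s)"
            unfolding id using le by (rule add_right_mono)
          then show ?thesis using False by (simp add: add.commute[of _ "bT UNIV"] enat_add_left_cancel_le)
        qed
        moreover obtain k where "b k < a k \<or> \<not> closed (ran_on (X k) (E k))"
          using L True left_weyl_iff not_le by metis
        ultimately show False using nD True by blast
      next
        case False
        \<comment> \<open>The first infinite nullity, so that everything below it satisfies the
          finiteness condition of Delta_1.\<close>
        define k where "k = Min {s. a s = \<infinity>}"
        have ne: "{s. a s = \<infinity>} \<noteq> {}" using False by auto
        have k: "a k = \<infinity>" using Min_in[OF _ ne] by (simp add: k_def)
        have below: "a s < \<infinity>" if "s < k" for s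
          using that Min_le[of "{s. a s = \<infinity>}" s] by (fastforce simp: k_def)
        have "k \<noteq> Min UNIV" using k first(1) by auto
        moreover have inf: "(\<Sum>s\<in>{s. s < k}. b s) = \<infinity>" by (rule beta_sum_infinite[OF fin k below])
        \<comment> \<open>The comparison of total sums in Delta_1 holds because a partial sum of the
          deficiencies is already infinite.\<close>
        moreover have "(\<Sum>s\<in>{s. s < k}. b s) \<le> (\<Sum>s\<in>UNIV. b s)" by (rule sum_mono2) auto
        then have "(\<Sum>s\<in>UNIV. a s) \<le> (\<Sum>s\<in>UNIV. b s)" unfolding inf by (simp add: top.extremum_unique)
        ultimately show False using nD k below first' by blast
      qed
    qed
  qed
next
  assume R: "?W \<or> ?D1 \<or> ?D2"
  show ?L
  proof (rule ccontr)
    assume "\<not> ?L"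
    then have all: "a k < \<infinity>" "closed (ran_on (X k) (E k))" "a k \<le> b k" for k
      by (simp_all add: left_weyl_iff)
    have "\<not> ?D1" using all(1) by (metis less_irrefl)
    moreover have "\<not> ?D2" using all(2,3) by (simp add: not_less)
    ultimately have W: ?W using R by blast
    have id: "(\<Sum>s\<in>UNIV. a s) + bT UNIV = aT UNIV + (\<Sum>s\<in>UNIV. b s)" "aT UNIV \<le> (\<Sum>s\<in>UNIV. a s)"
      using index_sum[of UNIV] all(1) by auto
    have fin: "(\<Sum>s\<in>UNIV. a s) < \<infinity>" using all(1) by (intro sum_enat_finite)
    \<comment> \<open>By the index identity the right side is \<open>aT UNIV\<close> plus the sum of
      the deficiencies, which dominates entrywise; the finite sum of nullities then cancels.\<close>
    have "(\<Sum>s\<in>UNIV. a s) + aT UNIV \<le> (\<Sum>s\<in>UNIV. a s) + bT UNIV"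
      unfolding id(1) using sum_mono[of UNIV a b] all(3) by (simp add: add.commute add_left_mono)
    then have "aT UNIV \<le> bT UNIV" using fin by (auto simp: enat_add_left_cancel_le)
    moreover have "aT UNIV < \<infinity>" using id(2) fin by (rule le_less_trans)
    ultimately show False using W closed_range_T all by (simp add: left_weyl_T_iff)
  qed
qed

end

theorem mainTheorem1:
  fixes sc :: "complex \<Rightarrow> 'a::{real_inner,complete_space} \<Rightarrow> 'a"
    and X :: "'n::{finite,linorder} \<Rightarrow> 'a set"
    and D :: "'n \<Rightarrow> 'a \<Rightarrow> 'a"
    and A :: "'n \<Rightarrow> 'n \<Rightarrow> 'a \<Rightarrow> 'a"
  assumes n2: "CARD('n) \<ge> 2"
    and chs: "complex_hilbert_structure sc"
    and Xsub: "\<And>k. csubspace sc (X k) \<and> closed (X k)"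
    and Xinf: "\<And>k. cdim sc (X k) = \<infinity>"
    and Dbop: "\<And>k. bop sc (X k) sc (X k) (D k)"
    and ABn: "Bn sc X A"
  shows
    "(\<Union>k. sigma_lw sc (X k) (D k)) =
       sigma_lw (dsc sc) (dsum X) (Tnd D A)
     \<union> ((\<Union>k\<in>{k. k \<noteq> Min UNIV}.
           {z. alpha_op sc (X k) (minus_lam sc (D k) z) = \<infinity>
               \<and> (\<forall>s. Min UNIV < s \<and> s < k \<longrightarrow> alpha_op sc (X s) (minus_lam sc (D s) z) < \<infinity>)
               \<and> (\<Sum>s\<in>{s. s < k}. beta_op sc (X s) (minus_lam sc (D s) z)) = \<infinity>})
         \<inter> rho_le sc (X (Min UNIV)) (D (Min UNIV))
         \<inter> {z. (\<Sum>s\<in>UNIV. beta_op sc (X s) (minus_lam sc (D s) z))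
                 \<ge> (\<Sum>s\<in>UNIV. alpha_op sc (X s) (minus_lam sc (D s) z))})
     \<union> (\<Union>k. {z. (\<forall>s. alpha_op sc (X s) (minus_lam sc (D s) z) < \<infinity>)
               \<and> (\<Sum>s\<in>UNIV. beta_op sc (X s) (minus_lam sc (D s) z))
                   \<ge> (\<Sum>s\<in>UNIV. alpha_op sc (X s) (minus_lam sc (D s) z))
               \<and> (alpha_op sc (X k) (minus_lam sc (D k) z) > beta_op sc (X k) (minus_lam sc (D k) z)
                  \<or> \<not> closed (ran_on (X k) (minus_lam sc (D k) z)))})"
    (is "?lhs = ?rhs")
proof (rule set_eqI)
  fix z
  \<comment> \<open>The sign is that of D - z, as in the nullities and deficiencies of the
    statement; \<open>lam\<close> and \<open>lamT\<close> account for the opposite sign in the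
    spectra.\<close>
  define E where "E = (\<lambda>k x. minus_lam sc (D k) z (oproj (X k) x))"
  define A' where "A' = (\<lambda>i j x. A i j (oproj (X j) x))"
  have X: "csubspace sc (X k)" "closed (X k)" for k using Xsub by auto
  note E = linear_bop_oproj[OF chs X bop_minus_lam[where z = z, OF chs X(1) Dbop]]
  have A: "bop sc (X j) sc (X i) (A i j)" if "i < j" for i j using ABn that by (simp add: Bn_def)
  note A' = linear_bop_oproj[OF chs X A]
  interpret upper_triangular sc X E A'
  proof (rule upper_triangular.intro)
    show "E k x \<in> X k" if "x \<in> X k" for k x
      using that E(3)[OF that] bop_minus_lam[OF chs X(1) Dbop, of k z] by (auto simp: E_def bop_def)
    show "A' i j x \<in> X i" if "i < j" "x \<in> X j" for i j x
      using that A'(3)[OF that] A[OF that(1)] by (auto simp: A'_def bop_def)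
  qed (use chs X E(1,2) A'(1,2) in \<open>simp_all add: E_def A'_def\<close>)
  have E_eq: "E k x = minus_lam sc (D k) z x" if "x \<in> X k" for k x using E(3)[OF that] by (simp add: E_def)
  have A_eq: "A' i j x = A i j x" if "i < j" "x \<in> X j" for i j x using A'(3)[OF that] by (simp add: A'_def)
  have ker: "ker_on (X k) (minus_lam sc (D k) z) = ker_on (X k) (E k)" for k
    using E_eq by (auto simp: ker_on_def)
  have ran: "ran_on (X k) (minus_lam sc (D k) z) = ran_on (X k) (E k)" for k
    using E_eq by (simp add: ran_on_def)
  have al: "alpha_op sc (X k) (minus_lam sc (D k) z) = a k" for k by (simp add: alpha_op_def ker)
  have be: "beta_op sc (X k) (minus_lam sc (D k) z) = b k" for k by (simp add: beta_op_def ran)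
  have lam: "lam_minus sc z (D k) x = - E k x" if "x \<in> X k" for k x
    using E_eq[OF that] by (simp add: lam_minus_def minus_lam_def)
  note lw = left_weyl_uminus_cong[OF E_linear X_subspace lam]
  have lamT: "lam_minus (dsc sc) z (Tnd D A) x = - T x" if x: "x \<in> dsum X" for x
  proof -
    have xk: "x $ k \<in> X k" for k using x by (simp add: dsum_def)
    have "(\<Sum>j\<in>{j. i < j}. A' i j (x $ j)) = (\<Sum>j\<in>{j. i < j}. A i j (x $ j))" for i
      using A_eq xk by (intro sum.cong) auto
    then show ?thesis
      by (simp add: vec_eq_iff lam_minus_def dsc_def Tnd_def E_eq xk minus_lam_def)
  qed
  note lwT = left_weyl_uminus_cong(1)[OF T_linear dsum_subspace lamT]
  show "z \<in> ?lhs \<longleftrightarrow> z \<in> ?rhs"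
    using not_left_weyl_cases
    by (simp add: sigma_lw_def rho_le_def sigma_le_def al be ran lw lwT ex_disj_distrib conj_commute conj_left_commute
        del: not_infinity_eq)
qed

end
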